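(* There exists $\lambda_0>0$ such that for any $\lambda\in(0,\lambda_0]$, with $\mu_N=\mu_N(\lambda)$, and for any choice of $p\in(0,\frac12)$, there exist $\epsilon_p>0$ and a sequence $A_N$, independent of $n$ (but depending on $\lambda$ and $p$), such that $$c_n^{(N)} = A_N\,\mu_N^n\,\bigl[1+O(n^{-\epsilon_p})\bigr]$$ for all $n,N\in\mathbb{N}$ such that $n\le V^p$ and $\lambda V^{1/2}>1$ (where $V=2^N$). The constant in the error term depends on $\lambda$ and $p$ but not on $n$ or $N$ as long as $n\le V^p$.
   Context: Let $\mathbb{N}=\{1,2,\dots\}$. For $N\in\mathbb{N}$, $\mathbb{Q}^N=\mathbb{Z}_2^N$ is the $N$-dimensional hypercube (binary strings of length $N$, with coordinatewise addition mod 2), $V=V(N)=2^N$, and $|x|$ is the number of coordinates of $x\in\mathbb{Q}^N$ equal to 1. An $n$-step self-avoiding walk is a function $\omega:\{0,\dots,n\}\to\mathbb{Q}^N$ with $|\omega(i)-\omega(i-1)|=1$ for $1\le i\le n$ and $\omega(i)\ne\omega(j)$ for $i\neq j$. $c_n^{(N)}$ is the number of $n$-step self-avoiding walks with $\omega(0)=0$, with $c_0^{(N)}=1$. The susceptibility is the polynomial $\chi_N(z)=\sum_{n=0}^{V-1}c_n^{(N)}z^n$. For $\lambda>0$ with $\lambda V^{1/2}>1$, the critical value $z_N=z_N(\lambda)>0$ is the unique positive solution of $\chi_N(z_N)=\lambda V^{1/2}$, and the connective constant is $\mu_N(\lambda)=1/z_N(\lambda)$. *)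

theory Defs
  imports Complex_Main "HOL-Library.FuncSet" "HOL-Library.Z2"
begin

text \<open>Since the dimension varies, vertices of the hypercube are lists of length \<open>N\<close> over
  the field \<open>bit\<close> of integers mod 2.\<close>

definition cube :: "nat \<Rightarrow> bit list set"
  where "cube N = {x. length x = N}"

definition cube_zero :: "nat \<Rightarrow> bit list"
  where "cube_zero N = replicate N 0"

definition cube_diff :: "bit list \<Rightarrow> bit list \<Rightarrow> bit list"
  where "cube_diff x y = map2 (-) x y"

definition weight :: "bit list \<Rightarrow> nat"
  where "weight x = card {i. i < length x \<and> x ! i = 1}"

text \<open>Walks are extensional functions on \<open>{0..n}\<close>, so that counting them
  is counting functions with domain exactly \<open>{0..n}\<close>.\<close>

definition self_avoiding_walks :: "nat \<Rightarrow> nat \<Rightarrow> (nat \<Rightarrow> bit list) set"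
  where "self_avoiding_walks N n =
    {\<omega> \<in> {0..n} \<rightarrow>\<^sub>E cube N.
       (\<forall>i\<in>{1..n}. weight (cube_diff (\<omega> i) (\<omega> (i - 1))) = 1) \<and>
       (\<forall>i\<in>{0..n}. \<forall>j\<in>{0..n}. i \<noteq> j \<longrightarrow> \<omega> i \<noteq> \<omega> j)}"

definition saw_count :: "nat \<Rightarrow> nat \<Rightarrow> nat"
  where "saw_count N n = card {\<omega> \<in> self_avoiding_walks N n. \<omega> 0 = cube_zero N}"

definition volume :: "nat \<Rightarrow> nat"
  where "volume N = 2 ^ N"

definition susceptibility :: "nat \<Rightarrow> real \<Rightarrow> real"
  where "susceptibility N z = (\<Sum>n = 0..volume N - 1. real (saw_count N n) * z ^ n)"

text \<open>Meaningful for \<open>N \<ge> 1\<close> and \<open>lam * sqrt (volume N) > 1\<close>;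
  see \<open>critical_value_unique\<close> below.\<close>

definition critical_value :: "nat \<Rightarrow> real \<Rightarrow> real"
  where "critical_value N lam =
    (THE z. z > 0 \<and> susceptibility N z = lam * sqrt (real (volume N)))"

definition connective_constant :: "nat \<Rightarrow> real \<Rightarrow> real"
  where "connective_constant N lam = 1 / critical_value N lam"

lemma finite_self_avoiding_walks: "finite (self_avoiding_walks N n)"
proof -
  have "finite (cube N)"
  proof -
    have "(UNIV :: bit set) \<subseteq> {0, 1}"
      by auto
    then have "finite (UNIV :: bit set)"
      by (rule finite_subset) simp
    then show ?thesis
      using finite_lists_length_eq[of "UNIV :: bit set" N] by (simp add: cube_def)
  qed
  then have "finite ({0..n} \<rightarrow>\<^sub>E cube N)"
    by (simp add: finite_PiE)
  then show ?thesis
    by (simp add: self_avoiding_walks_def)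
qed

lemma saw_count_0: "saw_count N 0 = 1"
proof -
  have "{\<omega> \<in> self_avoiding_walks N 0. \<omega> 0 = cube_zero N} = {\<lambda>i\<in>{0}. cube_zero N}"
    by (auto simp: self_avoiding_walks_def cube_def cube_zero_def fun_eq_iff PiE_def extensional_def)
  then show ?thesis
    by (simp add: saw_count_def)
qed

lemma saw_count_1_pos:
  assumes "N \<ge> 1"
  shows "saw_count N 1 > 0"
proof -
  obtain M where N: "N = Suc M"
    using assms by (cases N) auto
  define \<omega> :: "nat \<Rightarrow> bit list" where
    "\<omega> = (\<lambda>i\<in>{0..1}. if i = 0 then replicate N 0 else 1 # replicate M 0)"
  have diff: "cube_diff (1 # replicate M 0) (replicate N 0) = 1 # replicate M 0"
    by (simp add: cube_diff_def N zip_replicate)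
  have "{i. i < Suc M \<and> (1 # replicate M (0::bit)) ! i = 1} = {0}"
  proof -
    have "(1 # replicate M (0::bit)) ! i \<noteq> 1" if "i < Suc M" "i \<noteq> 0" for i
      using that by (cases i) auto
    then show ?thesis by (intro equalityI subsetI) (fastforce, simp)
  qed
  then have wt: "weight (1 # replicate M 0) = 1"
    by (simp add: weight_def)
  have "\<omega> \<in> self_avoiding_walks N 1"
    using diff wt 
    by (auto simp: self_avoiding_walks_def \<omega>_def cube_def N PiE_def extensional_def)
  moreover have "\<omega> 0 = cube_zero N"
    by (simp add: \<omega>_def cube_zero_def)
  ultimately show ?thesis
    using finite_self_avoiding_walks[of N 1] by (auto simp: saw_count_def card_gt_0_iff)
qed

lemma critical_value_unique:
  assumes "N \<ge> 1" and "lam * sqrt (real (volume N)) > 1"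
  shows "\<exists>!z. z > 0 \<and> susceptibility N z = lam * sqrt (real (volume N))"
proof -
  have one_in: "1 \<in> {0..volume N - 1}"
  proof -
    have "(2::nat) ^ 1 \<le> 2 ^ N"
      using assms(1) by (intro power_increasing) auto
    then show ?thesis by (simp add: volume_def)
  qed
  have mono: "susceptibility N x < susceptibility N y" if "0 \<le> x" "x < y" for x y
    unfolding susceptibility_def
  proof (rule sum_strict_mono_ex1)
    show "\<forall>n\<in>{0..volume N - 1}. real (saw_count N n) * x ^ n \<le> real (saw_count N n) * y ^ n"
      using that by (auto intro!: mult_left_mono power_mono)
    show "\<exists>n\<in>{0..volume N - 1}. real (saw_count N n) * x ^ n < real (saw_count N n) * y ^ n"
      using that saw_count_1_pos[OF assms(1)] one_in by (intro bexI[of _ 1]) auto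
  qed simp
  have at0: "susceptibility N 0 = 1"
    by (simp add: susceptibility_def power_0_left saw_count_0 sum.delta if_distrib cong: if_cong)
  let ?L = "lam * sqrt (real (volume N))"
  have "?L \<le> real (saw_count N 1) * ?L ^ 1"
    using mult_right_mono[of 1 "real (saw_count N 1)" ?L] saw_count_1_pos[OF assms(1)] assms(2)
    by simp
  also have "\<dots> \<le> susceptibility N ?L"
    unfolding susceptibility_def using one_in assms(2)
    by (intro member_le_sum[where f = "\<lambda>n. real (saw_count N n) * ?L ^ n"]) auto
  finally have upper: "?L \<le> susceptibility N ?L" .
  have "\<exists>z\<ge>0. z \<le> ?L \<and> susceptibility N z = ?L"
    using at0 upper assms(2)
    by (intro IVT') (auto simp: susceptibility_def intro!: continuous_intros)
  then obtain z where z: "z \<ge> 0" "susceptibility N z = ?L"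
    by blast
  then have "z > 0"
    using at0 assms(2) by (cases "z = 0") auto
  then show ?thesis
    using z mono by (metis less_imp_le linorder_neqE_linordered_idom order_less_irrefl)
qed

end

theory Submission
  imports Defs "HOL-Library.Sublist"
begin

text \<open>
  A walk from the origin is the word of coordinates that it flips; it is self-avoiding iff no
  nonempty contiguous subword contains every letter an even number of times. Fix a memory
  \<open>L = K N\<close> and forbid only closed subwords of length at most \<open>L\<close>. A Fourier computation shows
  that closed words of length \<open>m \<le> L\<close> have density at most \<open>(B / N) exp (- \<gamma> m)\<close>, so the
  count \<open>c\<close> of the words with memory satisfies \<open>c (n + 1) \<ge> (N - h) c n\<close> and is
  supermultiplicative up to a factor \<open>1 - O(1/N)\<close>.

  The ratio \<open>c (n + 1) / c n\<close> stabilises by an exchange argument: given a word of length \<open>n + 2\<close> and one of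
  length \<open>n\<close>, exchange their tails at the first of many well separated cut points at which both
  new words are admissible. This is an involution onto pairs of words of length \<open>n + 1\<close>, and
  each cut point fails with probability \<open>O(1/N)\<close>, nearly independently, so
  \<open>c (n + 2) c n - c (n + 1)\<^sup>2\<close> is tiny. Cuts at distance about \<open>sqrt n\<close> give
  \<open>c n = A \<mu>\<^sup>n (1 + O(1/n))\<close> uniformly in \<open>N\<close>. Longer closed subwords
  cost only a relative error \<open>n\<^sup>2 / V\<close> up to an arbitrarily small power of \<open>V\<close>,
  because after \<open>K N\<close> steps the walk is nearly uniformly distributed.

  Finally, with \<open>M\<close> a power of \<open>V\<close> slightly above \<open>V\<close> to the power \<open>p\<close>, the single term
  \<open>n = M\<close> of the susceptibility bounds the critical value from above and submultiplicativity
  bounds it from below, so that \<open>\<mu> z = 1 + O(N\<^sup>2 / M)\<close>.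
\<close>

section \<open>Words with forbidden closed subwords\<close>

text \<open>The vertex that the word reaches from the origin, encoded as a set of coordinates;
  addition mod 2 becomes symmetric difference, and a closed word is one where this set is
  empty.\<close>

definition odd_letters :: "nat list \<Rightarrow> nat set"
  where "odd_letters w = {i. odd (count_list w i)}"

text \<open>\<open>D\<close> is the memory: returns after more than \<open>D\<close> steps are
  tolerated. For \<open>D\<close> at least the length of the word this is full self-avoidance, see
  \<open>avoiding_length\<close>.\<close>

definition avoiding :: "nat \<Rightarrow> nat list \<Rightarrow> bool"
  where "avoiding D w \<longleftrightarrow> (\<forall>q. sublist q w \<longrightarrow> q \<noteq> [] \<longrightarrow> odd_letters q = {} \<longrightarrow> D < length q)"

definition awords :: "nat \<Rightarrow> nat \<Rightarrow> nat \<Rightarrow> nat list set"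
  where "awords N D n = {w. set w \<subseteq> {..<N} \<and> length w = n \<and> avoiding D w}"

definition loops :: "nat \<Rightarrow> nat \<Rightarrow> nat list set"
  where "loops N m = {w. set w \<subseteq> {..<N} \<and> length w = m \<and> odd_letters w = {}}"

definition num_awords :: "nat \<Rightarrow> nat \<Rightarrow> nat \<Rightarrow> real"
  where "num_awords N D n = real (card (awords N D n))"

lemma odd_letters_Nil [simp]: "odd_letters [] = {}"
  by (simp add: odd_letters_def)

lemma odd_letters_append: "odd_letters (u @ v) = sym_diff (odd_letters u) (odd_letters v)"
  by (auto simp: odd_letters_def)

lemma odd_letters_Cons: "odd_letters (a # v) = sym_diff {a} (odd_letters v)"
  by (auto simp: odd_letters_def)

lemma odd_letters_subset: "odd_letters w \<subseteq> set w"
  by (auto simp: odd_letters_def dest: odd_pos) (metis count_notin even_zero)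

lemma finite_words: "finite {w. set w \<subseteq> {..<N::nat} \<and> length w = n}"
  using finite_lists_length_eq[of "{..<N}" n] by simp

lemma finite_awords [simp]: "finite (awords N D n)"
  unfolding awords_def by (rule finite_subset[OF _ finite_words[of N n]]) auto

lemma finite_loops [simp]: "finite (loops N n)"
  unfolding loops_def by (rule finite_subset[OF _ finite_words[of N n]]) auto

lemma avoiding_sublist: "avoiding D w \<Longrightarrow> sublist q w \<Longrightarrow> avoiding D q"
  unfolding avoiding_def using sublist_order.order.trans by blast

lemma avoiding_take: "avoiding D w \<Longrightarrow> avoiding D (take i w)"
  using avoiding_sublist sublist_take by blast

lemma avoiding_drop: "avoiding D w \<Longrightarrow> avoiding D (drop i w)"
  using avoiding_sublist sublist_drop by blast

text \<open>A forbidden subword has length at most \<open>D\<close>, so one that starts in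
  \<open>p\<close> ends before \<open>q\<close> is exhausted; no forbidden subword can see both
  \<open>p\<close> and \<open>s\<close>. All locality in the exchange of tails comes from
  this.\<close>

lemma avoiding_append_iff:
  assumes "D \<le> length q"
  shows "avoiding D (p @ q @ s) \<longleftrightarrow> avoiding D (p @ q) \<and> avoiding D (q @ s)"
proof
  assume *: "avoiding D (p @ q @ s)"
  show "avoiding D (p @ q) \<and> avoiding D (q @ s)"
    using avoiding_sublist[OF *, of "p @ q"] avoiding_sublist[OF *, of "q @ s"]
    by (metis append.assoc sublist_appendI sublist_append_leftI sublist_append_rightI)
next
  assume *: "avoiding D (p @ q) \<and> avoiding D (q @ s)"
  show "avoiding D (p @ q @ s)"
    unfolding avoiding_def
  proof (intro allI impI)
    fix y assume y: "sublist y (p @ q @ s)" "y \<noteq> []" "odd_letters y = {}"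
    show "D < length y"
    proof (rule ccontr)
      assume short: "\<not> D < length y"
      from y(1) consider "sublist y p" | "sublist y (q @ s)"
        | y1 y2 where "y = y1 @ y2" "suffix y1 p" "prefix y2 (q @ s)"
        by (auto simp: sublist_append)
      then show False
      proof cases
        case 1
        then have "sublist y (p @ q)"
          by (simp add: sublist_append)
        then show False using * y short by (auto simp: avoiding_def)
      next
        case 2
        then show False using * y short by (auto simp: avoiding_def)
      next
        case 3
        have "length y2 \<le> length q" using 3 short assms by simp
        then have "prefix y2 q" using 3(3)
          by (metis prefix_length_prefix prefixI)
        then have "sublist y (p @ q)"
          using 3 by (auto simp: sublist_append)
        then show False using * y short by (auto simp: avoiding_def)
      qed
    qed
  qed
qed

lemma avoiding_single [simp]: "avoiding D [a]"
  by (auto simp: avoiding_def sublist_Cons_right odd_letters_Cons prefix_Cons)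

lemma avoiding_Nil [simp]: "avoiding D []"
  by (auto simp: avoiding_def)

lemma inj_on_split: "inj_on (\<lambda>w. (take a w, drop a w)) X"
  by (rule inj_onI) (metis append_take_drop_id prod.inject)

lemma take_awords: "w \<in> awords N D (a + b) \<Longrightarrow> take a w \<in> awords N D a"
  by (auto simp: awords_def avoiding_take dest: in_set_takeD)

lemma drop_awords: "w \<in> awords N D (a + b) \<Longrightarrow> drop a w \<in> awords N D b"
  by (auto simp: awords_def avoiding_drop dest: in_set_dropD)

lemmas awords_split = take_awords drop_awords

lemma num_awords_0: "num_awords N D 0 = 1"
proof -
  have "awords N D 0 = {[]}" by (auto simp: awords_def)
  then show ?thesis by (simp add: num_awords_def)
qed

lemma num_awords_1: "num_awords N D 1 = real N"
proof -
  have "awords N D 1 = (\<lambda>a. [a]) ` {..<N}"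
    by (auto simp: awords_def length_Suc_conv)
  then show ?thesis by (simp add: num_awords_def card_image inj_on_def)
qed

lemma num_awords_nonneg [simp]: "num_awords N D n \<ge> 0"
  by (simp add: num_awords_def)

lemma num_awords_add_le: "num_awords N D (a + b) \<le> num_awords N D a * num_awords N D b"
proof -
  have "card (awords N D (a + b)) \<le> card (awords N D a \<times> awords N D b)"
    by (rule card_inj_on_le[OF inj_on_split]) (auto dest: awords_split)
  then have "card (awords N D (a + b)) \<le> card (awords N D a) * card (awords N D b)"
    by (simp add: card_cartesian_product)
  then show ?thesis
    unfolding num_awords_def by (metis of_nat_le_iff of_nat_mult)
qed

section \<open>The cost of concatenating two admissible words\<close>

definition fails :: "nat \<Rightarrow> nat \<Rightarrow> nat \<Rightarrow> nat \<Rightarrow> (nat list \<times> nat list) set"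
  where "fails N D a b =
    {(p, q). p \<in> awords N D a \<and> q \<in> awords N D b \<and> \<not> avoiding D (p @ q)}"

lemma finite_fails [simp]: "finite (fails N D a b)"
proof (rule finite_subset)
  show "fails N D a b \<subseteq> awords N D a \<times> awords N D b"
    by (auto simp: fails_def)
qed simp

lemma card_fails_eq: "real (card (fails N D a b)) = num_awords N D a * num_awords N D b - num_awords N D (a + b)"
proof -
  have "awords N D a \<times> awords N D b =
      fails N D a b \<union> (\<lambda>w. (take a w, drop a w)) ` awords N D (a + b)"
    (is "?P = ?F \<union> ?I")
  proof (intro equalityI subsetI)
    fix z assume "z \<in> ?P"
    then obtain p q where z: "z = (p, q)" "p \<in> awords N D a" "q \<in> awords N D b" by auto
    show "z \<in> ?F \<union> ?I"
    proof (cases "avoiding D (p @ q)")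
      case True
      then have "p @ q \<in> awords N D (a + b)" using z by (auto simp: awords_def)
      moreover have "z = (take a (p @ q), drop a (p @ q))" using z by (auto simp: awords_def)
      ultimately show ?thesis by blast
    qed (use z in \<open>auto simp: fails_def\<close>)
  next
    fix z assume "z \<in> ?F \<union> ?I"
    then show "z \<in> ?P"
      by (auto simp: fails_def dest: awords_split)
  qed
  moreover have "?F \<inter> ?I = {}"
  proof (rule equals0I)
    fix z assume "z \<in> ?F \<inter> ?I"
    then obtain w where w: "w \<in> awords N D (a + b)" "(take a w, drop a w) \<in> ?F" by auto
    then show False by (simp add: fails_def awords_def)
  qed
  moreover have "card ?I = card (awords N D (a + b))"
    by (rule card_image[OF inj_on_split])
  ultimately have "card (awords N D a) * card (awords N D b) = card ?F + card (awords N D (a + b))"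
    using card_Un_disjoint[of ?F ?I]
    by (simp only: card_cartesian_product[symmetric] finite_awords finite_fails finite_imageI)
  then have "real (card (awords N D a) * card (awords N D b)) =
      real (card ?F + card (awords N D (a + b)))" by (rule arg_cong)
  then show ?thesis unfolding num_awords_def of_nat_add of_nat_mult by linarith
qed

text \<open>If both factors are admissible, a short closed subword of the concatenation must
  straddle the junction, with \<open>i\<close> letters on the left and \<open>j\<close> on the
  right. Cutting it out leaves two shorter admissible words, and the removed piece is relaxed to an
  arbitrary closed word.\<close>

lemma card_fails_le:
  "real (card (fails N D a b)) \<le>
    (\<Sum>i=1..a. \<Sum>j=1..b. if i + j \<le> D
       then num_awords N D (a - i) * real (card (loops N (i + j))) * num_awords N D (b - j) else 0)"
proof -
  define I where "I = {(i, j). i \<in> {1..a} \<and> j \<in> {1..b} \<and> i + j \<le> D}"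
  define X where "X i j = awords N D (a - i) \<times> loops N (i + j) \<times> awords N D (b - j)" for i j
  define \<Phi> where "\<Phi> i j = (\<lambda>(p, l, q). (p @ take i l, drop i l @ q) :: nat list \<times> nat list)" for i j :: nat
  have finI: "finite I"
    by (rule finite_subset[of _ "{1..a} \<times> {1..b}"]) (auto simp: I_def)
  have "fails N D a b \<subseteq> (\<Union>(i, j)\<in>I. \<Phi> i j ` X i j)"
  proof
    fix z assume "z \<in> fails N D a b"
    then obtain p q where z: "z = (p, q)" "p \<in> awords N D a" "q \<in> awords N D b"
      "\<not> avoiding D (p @ q)" by (auto simp: fails_def)
    then obtain y where y: "sublist y (p @ q)" "y \<noteq> []" "odd_letters y = {}" "length y \<le> D"
      by (auto simp: avoiding_def not_less)
    have "\<not> sublist y p" "\<not> sublist y q"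
      using y z by (auto simp: awords_def avoiding_def)
    then obtain y1 y2 where yy: "y = y1 @ y2" "suffix y1 p" "prefix y2 q"
      using y(1) by (auto simp: sublist_append)
    have ne: "y1 \<noteq> []" "y2 \<noteq> []"
      using yy \<open>\<not> sublist y p\<close> \<open>\<not> sublist y q\<close> by auto
    obtain p' where p': "p = p' @ y1" using yy by (auto simp: suffix_def)
    obtain q' where q': "q = y2 @ q'" using yy by (auto simp: prefix_def)
    have "(length y1, length y2) \<in> I"
      using z ne y yy p' q' by (auto simp: I_def awords_def Suc_le_eq)
    moreover have "(p', y, q') \<in> X (length y1) (length y2)"
      using z p' q' yy y by (auto simp: X_def awords_def loops_def
          intro: avoiding_sublist)
    moreover have "z = \<Phi> (length y1) (length y2) (p', y, q')"
      using z p' q' yy by (simp add: \<Phi>_def)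
    ultimately show "z \<in> (\<Union>(i, j)\<in>I. \<Phi> i j ` X i j)" by blast
  qed
  then have "card (fails N D a b) \<le> card (\<Union>(i, j)\<in>I. \<Phi> i j ` X i j)"
    using finI by (intro card_mono) (auto simp: X_def)
  also have "\<dots> \<le> (\<Sum>(i, j)\<in>I. card (\<Phi> i j ` X i j))"
    using card_UN_le[OF finI, of "\<lambda>(i, j). \<Phi> i j ` X i j"] by (simp add: case_prod_unfold)
  also have "\<dots> \<le> (\<Sum>(i, j)\<in>I. card (X i j))"
    by (intro sum_mono, clarify, rule card_image_le) (simp add: X_def)
  finally have "real (card (fails N D a b)) \<le> real (\<Sum>(i, j)\<in>I. card (X i j))"
    by linarith
  also have "\<dots> = (\<Sum>(i, j)\<in>I. num_awords N D (a - i) * real (card (loops N (i + j))) * num_awords N D (b - j))"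
    by (simp add: X_def num_awords_def case_prod_unfold mult.assoc)
  also have "\<dots> = (\<Sum>(i, j)\<in>{1..a} \<times> {1..b}. if i + j \<le> D
       then num_awords N D (a - i) * real (card (loops N (i + j))) * num_awords N D (b - j) else 0)"
    by (rule sum.mono_neutral_cong_left) (auto simp: I_def split: if_splits)
  finally show ?thesis by (simp add: sum.cartesian_product)
qed

section \<open>Words with prescribed parities\<close>

definition parity_words :: "nat \<Rightarrow> nat \<Rightarrow> nat set \<Rightarrow> nat list set"
  where "parity_words N m x = {w. set w \<subseteq> {..<N} \<and> length w = m \<and> odd_letters w = x}"

text \<open>The numbers \<open>real N - 2 * real (card S)\<close> are the eigenvalues of the
  adjacency matrix of the hypercube, indexed by its characters \<open>S\<close>. Equivalently, this
  is the absolute moment of order \<open>m\<close> of a sum of \<open>N\<close> independent uniform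
  signs.\<close>

definition abs_moment :: "nat \<Rightarrow> nat \<Rightarrow> real"
  where "abs_moment N m = (\<Sum>S\<in>Pow {..<N}. \<bar>real N - 2 * real (card S)\<bar> ^ m) / 2 ^ N"

lemma finite_parity_words [simp]: "finite (parity_words N m x)"
  unfolding parity_words_def by (rule finite_subset[OF _ finite_words[of N m]]) auto

text \<open>Orthogonality of characters: the sum factorises over the elements of \<open>A\<close>,
  and an element of \<open>x\<close> contributes the factor \<open>-1 + 1\<close>.\<close>

lemma sum_character:
  assumes "finite A" "x \<subseteq> A"
  shows "(\<Sum>S\<in>Pow A. (-1) ^ card (S \<inter> x)) = (if x = {} then 2 ^ card A else (0::real))"
proof -
  let ?f = "\<lambda>i. if i \<in> x then -1 else (1::real)"
  have "(\<Sum>S\<in>Pow A. (-1::real) ^ card (S \<inter> x)) = (\<Sum>S\<in>Pow A. prod ?f S * (\<Prod>i\<in>A - S. 1))"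
  proof (rule sum.cong[OF refl])
    fix S assume "S \<in> Pow A"
    then have "finite S" using assms finite_subset by blast
    then show "(-1::real) ^ card (S \<inter> x) = prod ?f S * (\<Prod>i\<in>A - S. 1)"
      by (simp add: prod.If_cases)
  qed
  also have "\<dots> = (\<Prod>i\<in>A. ?f i + 1)"
    using prod_add[OF assms(1), of ?f "\<lambda>_. 1"] by simp
  also have "\<dots> = (if x = {} then 2 ^ card A else 0)"
    using assms by (auto intro: prod_zero)
  finally show ?thesis .
qed

lemma card_parity_words_Suc:
  "card (parity_words N (Suc m) x) = (\<Sum>i<N. card (parity_words N m (sym_diff {i} x)))"
proof -
  have "parity_words N (Suc m) x = (\<Union>i<N. (#) i ` parity_words N m (sym_diff {i} x))"
    (is "_ = ?R")
  proof (intro equalityI subsetI)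
    fix w assume w: "w \<in> parity_words N (Suc m) x"
    then obtain i v where "w = i # v" by (auto simp: parity_words_def length_Suc_conv)
    moreover from this w have "i < N" "v \<in> parity_words N m (sym_diff {i} x)"
      by (auto simp: parity_words_def odd_letters_Cons)
    ultimately show "w \<in> ?R" by blast
  next
    fix w assume "w \<in> ?R"
    then show "w \<in> parity_words N (Suc m) x"
      by (auto simp: parity_words_def odd_letters_Cons)
  qed
  then have "card (parity_words N (Suc m) x) =
      (\<Sum>i<N. card ((#) i ` parity_words N m (sym_diff {i} x)))"
    by (simp only:) (rule card_UN_disjoint, auto)
  then show ?thesis by (simp add: card_image)
qed

lemma sum_sign: "S \<subseteq> {..<N} \<Longrightarrow> (\<Sum>i<N. if i \<in> S then -1 else 1) = real N - 2 * real (card S)"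
proof -
  assume S: "S \<subseteq> {..<N}"
  then have "finite S" "card S \<le> N" using finite_subset card_mono[of "{..<N}" S] by auto
  moreover have "{..<N} \<inter> S = S" "card ({..<N} \<inter> - S) = N - card S"
    using S \<open>finite S\<close> by (auto simp: card_Diff_subset simp flip: Diff_eq)
  ultimately show ?thesis by (simp add: sum.If_cases of_nat_diff)
qed

text \<open>Fourier inversion on the hypercube, by induction on the first letter: flipping
  coordinate \<open>i\<close> changes the sign of the character \<open>S\<close> iff
  \<open>i\<close> lies in \<open>S\<close>, and summing these signs over \<open>i\<close> gives one
  more eigenvalue factor (\<open>sum_sign\<close>).\<close>

lemma card_parity_words:
  assumes "x \<subseteq> {..<N}"
  shows "real (card (parity_words N m x)) =
    (\<Sum>S\<in>Pow {..<N}. (-1) ^ card (S \<inter> x) * (real N - 2 * real (card S)) ^ m) / 2 ^ N"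
  using assms
proof (induction m arbitrary: x)
  case 0
  have "parity_words N 0 x = (if x = {} then {[]} else {})"
    by (auto simp: parity_words_def)
  then show ?case using sum_character[of "{..<N}" x] 0 by simp
next
  case (Suc m)
  have sign: "(-1::real) ^ card (S \<inter> sym_diff {i} x) =
      (-1) ^ card (S \<inter> x) * (if i \<in> S then -1 else 1)" if "S \<subseteq> {..<N}" for S i
  proof -
    have fin: "finite (S \<inter> x)" using that finite_subset by blast
    consider "i \<notin> S" | "i \<in> S" "i \<in> x" | "i \<in> S" "i \<notin> x" by blast
    then show ?thesis
    proof cases
      case 1
      then have "S \<inter> sym_diff {i} x = S \<inter> x" by auto
      then show ?thesis using 1 by simp
    next
      case 2
      then have "S \<inter> sym_diff {i} x = (S \<inter> x) - {i}" "i \<in> S \<inter> x" by auto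
      then have "card (S \<inter> x) = Suc (card (S \<inter> sym_diff {i} x))"
        using fin by (metis card.remove)
      then show ?thesis using 2 by simp
    next
      case 3
      then have "S \<inter> sym_diff {i} x = insert i (S \<inter> x)" "i \<notin> S \<inter> x" by auto
      then show ?thesis using 3 fin by simp
    qed
  qed
  have "real (card (parity_words N (Suc m) x)) =
      (\<Sum>i<N. real (card (parity_words N m (sym_diff {i} x))))"
    by (simp add: card_parity_words_Suc)
  also have "\<dots> = (\<Sum>i<N. (\<Sum>S\<in>Pow {..<N}. (-1) ^ card (S \<inter> sym_diff {i} x) *
      (real N - 2 * real (card S)) ^ m) / 2 ^ N)"
    using Suc.prems by (intro sum.cong refl Suc.IH) auto
  also have "\<dots> = (\<Sum>S\<in>Pow {..<N}. \<Sum>i<N. (-1) ^ card (S \<inter> sym_diff {i} x) *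
      (real N - 2 * real (card S)) ^ m) / 2 ^ N"
    by (subst sum.swap) (simp add: sum_divide_distrib)
  also have "(\<Sum>S\<in>Pow {..<N}. \<Sum>i<N. (-1) ^ card (S \<inter> sym_diff {i} x) *
      (real N - 2 * real (card S)) ^ m) =
      (\<Sum>S\<in>Pow {..<N}. (-1) ^ card (S \<inter> x) * (real N - 2 * real (card S)) ^ Suc m)"
  proof (rule sum.cong[OF refl])
    fix S assume "S \<in> Pow {..<N}"
    then have S: "S \<subseteq> {..<N}" by simp
    have "(\<Sum>i<N. (-1) ^ card (S \<inter> sym_diff {i} x) * (real N - 2 * real (card S)) ^ m) =
       (\<Sum>i<N. (if i \<in> S then -1 else 1) * ((-1) ^ card (S \<inter> x) * (real N - 2 * real (card S)) ^ m))"
      by (rule sum.cong[OF refl], subst sign[OF S]) (simp add: mult_ac)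
    also have "\<dots> = (real N - 2 * real (card S)) * ((-1) ^ card (S \<inter> x) * (real N - 2 * real (card S)) ^ m)"
      by (simp only: sum_distrib_right[symmetric] sum_sign[OF S])
    finally show "(\<Sum>i<N. (-1) ^ card (S \<inter> sym_diff {i} x) * (real N - 2 * real (card S)) ^ m) =
        (-1) ^ card (S \<inter> x) * (real N - 2 * real (card S)) ^ Suc m" by simp
  qed
  finally show ?case .
qed

text \<open>Taking absolute values removes the dependence on the endpoint, so one quantity controls
  closed words as well as words with any prescribed endpoint.\<close>

lemma card_parity_words_le: "real (card (parity_words N m x)) \<le> abs_moment N m"
proof (cases "x \<subseteq> {..<N}")
  case True
  have "(\<Sum>S\<in>Pow {..<N}. (-1) ^ card (S \<inter> x) * (real N - 2 * real (card S)) ^ m) \<le>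
      (\<Sum>S\<in>Pow {..<N}. \<bar>real N - 2 * real (card S)\<bar> ^ m)"
    by (rule sum_mono, rule order_trans[OF abs_ge_self]) (simp add: abs_mult power_abs)
  then show ?thesis
    unfolding card_parity_words[OF True] abs_moment_def by (simp add: divide_right_mono)
next
  case False
  then have "parity_words N m x = {}"
    using odd_letters_subset by (auto simp: parity_words_def)
  then show ?thesis by (simp add: abs_moment_def sum_nonneg)
qed

lemma card_loops_le: "real (card (loops N m)) \<le> abs_moment N m"
  using card_parity_words_le[of N m "{}"] by (simp add: loops_def parity_words_def)

lemma abs_moment_nonneg: "abs_moment N m \<ge> 0"
  by (simp add: abs_moment_def sum_nonneg)

section \<open>Bounds for the absolute moments, for short and for long words\<close>

lemma sum_Pow_powers:
  fixes a b :: "'a :: comm_semiring_1"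
  shows "(\<Sum>S\<in>Pow {..<N}. a ^ card S * b ^ (N - card S)) = (a + b) ^ N"
proof -
  have "(a + b) ^ N = (\<Prod>i<N. a + b)" by simp
  also have "\<dots> = (\<Sum>S\<in>Pow {..<N}. a ^ card S * b ^ (N - card S))"
    unfolding prod_add[OF finite_lessThan]
    by (rule sum.cong[OF refl])
      (auto simp: card_Diff_subset finite_subset[OF _ finite_lessThan])
  finally show ?thesis by simp
qed

lemma power_le_fact_exp:
  fixes y :: real
  assumes "y \<ge> 0"
  shows "y ^ m \<le> fact m * exp y"
proof -
  have "y ^ m /\<^sub>R fact m \<le> (\<Sum>n. y ^ n /\<^sub>R fact n)"
    using sum_le_suminf[OF summable_exp_generic[of y], of "{m}"] assms by simp
  then have "y ^ m /\<^sub>R fact m \<le> exp y" by (simp add: exp_def)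
  then show ?thesis by (simp add: divide_inverse[symmetric] field_simps)
qed

lemma cosh_bound:
  fixes t :: real
  assumes "0 \<le> t" "t \<le> 1"
  shows "exp t + exp (- t) \<le> 2 * exp (t\<^sup>2)"
proof -
  have "exp (- t) \<le> 1 - t + t\<^sup>2"
  proof -
    \<comment> \<open>The product equals 1 + t^3.\<close>
    have "1 \<le> (1 + t) * (1 - t + t\<^sup>2)"
      using assms by (simp add: algebra_simps power2_eq_square)
    also have "\<dots> \<le> exp t * (1 - t + t\<^sup>2)"
      using assms exp_ge_add_one_self[of t]
      by (intro mult_right_mono) (auto simp: power2_eq_square)
    finally show ?thesis by (simp add: exp_minus field_simps)
  qed
  moreover have "exp t \<le> 1 + t + t\<^sup>2" using exp_bound assms by simp
  moreover have "1 + t\<^sup>2 \<le> exp (t\<^sup>2)" by (rule exp_ge_add_one_self)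
  ultimately show ?thesis by linarith
qed

text \<open>An exponential moment bound: a power is at most a factorial times an exponential, and
  the exponential moment of a sum of signs is cosh(t)^N, at most exp(N t^2). The parameter
  \<open>t\<close> is left free for optimisation.\<close>

lemma abs_moment_le_exp:
  assumes t: "0 < t" "t \<le> 1"
  shows "abs_moment N m * t ^ m \<le> 2 * fact m * exp (real N * t\<^sup>2)"
proof -
  have half: "(\<Sum>S\<in>Pow {..<N}. exp (s * (real N - 2 * real (card S)))) = (exp s + exp (- s)) ^ N"
    for s :: real
  proof -
    have "exp (s * (real N - 2 * real (card S))) = exp (- s) ^ card S * exp s ^ (N - card S)"
      if "S \<subseteq> {..<N}" for S
    proof -
      have "card S \<le> N" using card_mono[OF _ that] by simp
      then have "s * (real N - 2 * real (card S)) = real (card S) * (- s) + real (N - card S) * s"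
        by (simp add: of_nat_diff algebra_simps)
      then show ?thesis by (simp only: exp_add exp_of_nat_mult)
    qed
    then show ?thesis
      using sum_Pow_powers[of "exp (- s)" "exp s" N] by (simp add: add.commute)
  qed
  have "abs_moment N m * t ^ m = (\<Sum>S\<in>Pow {..<N}. (t * \<bar>real N - 2 * real (card S)\<bar>) ^ m) / 2 ^ N"
    by (simp add: abs_moment_def sum_distrib_left sum_distrib_right power_mult_distrib mult.commute)
  also have "\<dots> \<le> (\<Sum>S\<in>Pow {..<N}. fact m * (exp (t * (real N - 2 * real (card S)))
      + exp ((- t) * (real N - 2 * real (card S))))) / 2 ^ N"
  proof (intro divide_right_mono sum_mono)
    fix S
    let ?y = "real N - 2 * real (card S)"
    have "(t * \<bar>?y\<bar>) ^ m \<le> fact m * exp (t * \<bar>?y\<bar>)"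
      using t by (intro power_le_fact_exp) auto
    also have "\<dots> \<le> fact m * (exp (t * ?y) + exp ((- t) * ?y))"
    proof (intro mult_left_mono)
      have "t * \<bar>?y\<bar> = t * ?y \<or> t * \<bar>?y\<bar> = (- t) * ?y"
        by (cases "?y \<ge> 0") (auto simp: algebra_simps)
      then show "exp (t * \<bar>?y\<bar>) \<le> exp (t * ?y) + exp ((- t) * ?y)"
        by (metis add.commute add_increasing exp_ge_zero order_refl)
    qed simp
    finally show "(t * \<bar>?y\<bar>) ^ m \<le> fact m * (exp (t * ?y) + exp ((- t) * ?y))" .
  qed simp
  also have "\<dots> = 2 * fact m * ((exp t + exp (- t)) / 2) ^ N"
    unfolding sum_distrib_left[symmetric] sum.distrib half
    by (simp add: add.commute power_divide)
  also have "\<dots> \<le> 2 * fact m * exp (t\<^sup>2) ^ N"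
    using cosh_bound[of t] t by (intro mult_left_mono power_mono) (auto simp: add_nonneg_nonneg)
  finally show ?thesis by (simp add: exp_of_nat_mult)
qed

text \<open>For long words \<open>1 - 2k/N\<close> is replaced by \<open>exp (-2k/N)\<close>, which
  makes the sum over subsets binomial. Eigenvalues of both signs occur, hence the two terms with
  \<open>card S\<close> and \<open>N - card S\<close> and the factor 2.\<close>

lemma abs_moment_le_mixing:
  assumes "N \<ge> 1"
  shows "abs_moment N m \<le> 2 * real N ^ m * ((1 + exp (- 2 * real m / real N)) / 2) ^ N"
proof -
  let ?a = "exp (- 2 * real m / real N)"
  have pt: "\<bar>real N - 2 * real (card S)\<bar> ^ m \<le> real N ^ m * (?a ^ card S + ?a ^ (N - card S))"
    if "S \<subseteq> {..<N}" for S
  proof -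
    have c: "card S \<le> N" using card_mono[OF _ that] by simp
    have aux: "(real N - 2 * real k) ^ m \<le> real N ^ m * ?a ^ k" if "2 * real k \<le> real N" for k
    proof -
      have "real N - 2 * real k = real N * (1 + (- (2 * real k / real N)))"
        using assms by (simp add: field_simps)
      also have "\<dots> \<le> real N * exp (- (2 * real k / real N))"
        by (intro mult_left_mono exp_ge_add_one_self) auto
      finally have "(real N - 2 * real k) ^ m \<le> (real N * exp (- (2 * real k / real N))) ^ m"
        using that by (intro power_mono) auto
      also have "\<dots> = real N ^ m * ?a ^ k"
        by (simp add: power_mult_distrib mult_ac flip: exp_of_nat_mult)
      finally show ?thesis .
    qed
    show ?thesis
    proof (cases "2 * real (card S) \<le> real N")
      case True
      then show ?thesis using aux[of "card S"] by (simp add: distrib_left add_increasing2)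
    next
      case False
      then have "\<bar>real N - 2 * real (card S)\<bar> = real N - 2 * real (N - card S)"
        using c by (simp add: of_nat_diff)
      moreover have "(real N - 2 * real (N - card S)) ^ m \<le> real N ^ m * ?a ^ (N - card S)"
        using False c by (intro aux) (simp add: of_nat_diff)
      ultimately show ?thesis by (simp add: distrib_left add_increasing)
    qed
  qed
  have "abs_moment N m \<le> (\<Sum>S\<in>Pow {..<N}. real N ^ m * (?a ^ card S + ?a ^ (N - card S))) / 2 ^ N"
    unfolding abs_moment_def by (intro divide_right_mono sum_mono pt) auto
  also have "\<dots> = real N ^ m * (2 * (1 + ?a) ^ N) / 2 ^ N"
    using sum_Pow_powers[of ?a "1::real" N] sum_Pow_powers[of "1::real" ?a N]
    by (simp add: sum.distrib add.commute flip: sum_distrib_left)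
  finally show ?thesis by (simp add: power_divide mult_ac)
qed

lemma linear_le_exp: "(0::real) < a \<Longrightarrow> y * exp (- a * y) \<le> 1 / a"
proof -
  assume a: "0 < a"
  have "a * y \<le> exp (a * y)" using exp_ge_add_one_self[of "a * y"] by linarith
  then show ?thesis using a by (simp add: exp_minus field_simps)
qed

text \<open>The choice t^2 = m/N in the exponential moment bound gives, after squaring to get rid of
  the root, a factor \<open>z ^ m\<close> with z = e^2 m/N. Two of these factors supply the 1/N, the
  others the exponential decay.\<close>

lemma abs_moment_short:
  assumes N: "N \<ge> 1" and m: "m \<ge> 2" "32 * m \<le> N"
  shows "abs_moment N m \<le> real N ^ m * (8 * exp 3 / real N * exp (- real m / 4))"
proof -
  define t where "t = sqrt (real m / real N)"
  define z where "z = exp 2 * real m / real N"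
  have t: "0 < t" "t \<le> 1" "t\<^sup>2 = real m / real N"
    using assms by (auto simp: t_def)
  have z0: "0 \<le> z" by (simp add: z_def)
  \<comment> \<open>The restriction \<open>32 * m \<le> N\<close> is used through e^3 <= 27, which
    makes \<open>z\<close> at most 1/e.\<close>
  have "exp (1::real) \<le> 3" by (rule exp_le)
  then have "exp (1::real) ^ 3 \<le> 3 ^ 3" by (intro power_mono) auto
  then have e3: "exp (3::real) \<le> 27" by (simp flip: exp_of_nat_mult)
  have "z * exp 1 = exp 3 * real m / real N" by (simp add: z_def flip: exp_add)
  also have "\<dots> \<le> 27 * real m / real N"
    using e3 by (intro divide_right_mono mult_right_mono) auto
  also have "\<dots> \<le> 1" using assms by (simp add: field_simps)
  finally have z1: "z \<le> exp (- 1)" by (simp add: exp_minus field_simps)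
  have "abs_moment N m * t ^ m \<le> 2 * fact m * exp (real m)"
    using abs_moment_le_exp[OF t(1,2), of N m] N t(3) by simp
  also have "\<dots> \<le> 2 * real m ^ m * exp (real m)"
    using fact_le_power[of m, where ?'a = real] by (intro mult_right_mono mult_left_mono) auto
  finally have "abs_moment N m * t ^ m \<le> 2 * real m ^ m * exp (real m)" .
  then have "(abs_moment N m * t ^ m)\<^sup>2 \<le> (2 * real m ^ m * exp (real m))\<^sup>2"
    using t abs_moment_nonneg by (intro power_mono) auto
  also have "\<dots> = 4 * (z ^ m * (real N ^ m * real m ^ m))"
    using N by (simp add: z_def power_mult_distrib power_divide power2_eq_square
        flip: exp_of_nat_mult exp_add)
  also have "(abs_moment N m * t ^ m)\<^sup>2 = (abs_moment N m)\<^sup>2 * (t\<^sup>2) ^ m"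
    by (simp add: power_mult_distrib flip: power_mult) (simp add: mult.commute)
  finally have "(abs_moment N m)\<^sup>2 * (real m ^ m / real N ^ m) \<le> 4 * (z ^ m * (real N ^ m * real m ^ m))"
    by (simp add: t(3) power_divide)
  then have "(abs_moment N m)\<^sup>2 \<le> 4 * z ^ m * (real N ^ m)\<^sup>2"
    using N m by (simp add: field_simps power2_eq_square)
  also have "4 * z ^ m * (real N ^ m)\<^sup>2 = 4 * (z\<^sup>2 * z ^ (m - 2)) * (real N ^ m)\<^sup>2"
    by (metis m(1) le_add_diff_inverse power_add)
  also have "\<dots> \<le> 4 * (z\<^sup>2 * exp (- 1) ^ (m - 2)) * (real N ^ m)\<^sup>2"
    using z0 z1 by (intro mult_right_mono mult_left_mono power_mono) auto
  also have "exp (- 1 :: real) ^ (m - 2) = (exp (1 - real m / 2))\<^sup>2"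
    using m by (simp add: of_nat_diff flip: exp_of_nat_mult)
  also have "4 * (z\<^sup>2 * (exp (1 - real m / 2))\<^sup>2) * (real N ^ m)\<^sup>2 =
      (2 * z * exp (1 - real m / 2) * real N ^ m)\<^sup>2"
    by (simp add: power_mult_distrib)
  finally have "abs_moment N m \<le> 2 * z * exp (1 - real m / 2) * real N ^ m"
    by (rule power2_le_imp_le) (use z0 in auto)
  \<comment> \<open>The factor \<open>real m\<close> contained in \<open>z\<close> is absorbed by
    half of the exponential decay.\<close>
  also have "\<dots> = real N ^ m * (2 * exp 3 / real N * (real m * exp (- (1/4) * real m)) * exp (- real m / 4))"
    by (simp add: z_def field_simps flip: exp_add)
  also have "\<dots> \<le> real N ^ m * (2 * exp 3 / real N * (1 / (1/4)) * exp (- real m / 4))"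
    by (intro mult_left_mono mult_right_mono linear_le_exp) auto
  finally show ?thesis by simp
qed

text \<open>For m <= N/32 this is \<open>abs_moment_short\<close>. Between N/32 and
  \<open>K * N\<close> the mixing bound is exponentially small in \<open>N\<close>, hence also in
  \<open>m\<close>, at the price of constants that depend on \<open>K\<close>.\<close>

lemma abs_moment_decay:
  assumes K: "K \<ge> 1"
  shows "\<exists>B>0. \<exists>\<gamma>>0. \<forall>N m. N \<ge> 1 \<and> 2 \<le> m \<and> m \<le> K * N \<longrightarrow>
    abs_moment N m \<le> real N ^ m * (B / real N * exp (- \<gamma> * real m))"
proof -
  \<comment> \<open>The base of the mixing bound at m = N/32.\<close>
  define \<theta> :: real where "\<theta> = (1 + exp (- 1 / 16)) / 2"
  have \<theta>: "0 < \<theta>" "\<theta> < 1" by (auto simp: \<theta>_def add_pos_pos)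
  \<comment> \<open>With this choice \<theta>^N = exp (-2aN); one factor exp (-aN) pays for the 1/N,
    the other becomes the decay in \<open>m\<close>, because \<open>m \<le> K * N\<close>.\<close>
  define a where "a = - ln \<theta> / 2"
  have a: "a > 0" using \<theta> by (simp add: a_def)
  define \<gamma> where "\<gamma> = min (1 / 4) (a / real K)"
  define B where "B = max (8 * exp 3) (2 / a)"
  have \<gamma>: "\<gamma> > 0" using a K by (simp add: \<gamma>_def)
  have B: "B > 0" by (simp add: B_def less_max_iff_disj)
  have "abs_moment N m \<le> real N ^ m * (B / real N * exp (- \<gamma> * real m))"
    if N: "N \<ge> 1" and m: "2 \<le> m" "m \<le> K * N" for N m
  proof (cases "32 * m \<le> N")
    case True
    have "abs_moment N m \<le> real N ^ m * (8 * exp 3 / real N * exp (- real m / 4))"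
      by (rule abs_moment_short[OF N m(1) True])
    also have "\<dots> \<le> real N ^ m * (B / real N * exp (- \<gamma> * real m))"
    proof (intro mult_left_mono mult_mono divide_right_mono)
      have "\<gamma> \<le> 1 / 4" unfolding \<gamma>_def by (rule min.cobounded1)
      then have "\<gamma> * real m \<le> (1/4) * real m" by (intro mult_right_mono) auto
      then show "exp (- real m / 4) \<le> exp (- \<gamma> * real m)" by simp
    qed (use B in \<open>auto simp: B_def\<close>)
    finally show ?thesis .
  next
    case False
    have "(1 + exp (- 2 * real m / real N)) / 2 \<le> \<theta>"
    proof -
      have "- 2 * real m / real N \<le> - 1 / 16"
        using False N by (simp add: field_simps)
      then show ?thesis by (simp add: \<theta>_def)
    qed
    then have "abs_moment N m \<le> 2 * real N ^ m * \<theta> ^ N"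
      using abs_moment_le_mixing[OF N, of m]
      by (intro order_trans[OF abs_moment_le_mixing[OF N]] mult_left_mono power_mono)
        (auto simp: add_nonneg_nonneg)
    also have "\<theta> ^ N = exp (- 2 * a * real N)"
      using \<theta> by (simp add: a_def exp_of_nat_mult[symmetric] mult.commute)
        (simp add: exp_of_nat_mult)
    also have "2 * real N ^ m * exp (- 2 * a * real N) =
        real N ^ m * (2 * (real N * exp (- a * real N)) / real N * exp (- a * real N))"
      using N by (simp add: field_simps flip: exp_add)
    also have "\<dots> \<le> real N ^ m * (B / real N * exp (- \<gamma> * real m))"
    proof (intro mult_left_mono mult_mono divide_right_mono)
      show "2 * (real N * exp (- a * real N)) \<le> B"
        using linear_le_exp[OF a, of "real N"] by (simp add: B_def)
      have "\<gamma> * real m \<le> (a / real K) * (real K * real N)"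
        using m a by (intro mult_mono) (auto simp: \<gamma>_def simp flip: of_nat_mult)
      then show "exp (- a * real N) \<le> exp (- \<gamma> * real m)" using K by simp
    qed (use B in auto)
    finally show ?thesis .
  qed
  then show ?thesis using B \<gamma> by blast
qed

text \<open>After \<open>K * N\<close> steps the mixing bound has the factor (1 + exp (-2K))^N /
  2^N, and \<open>K\<close> is taken so large that exp (-2K) is at most \<epsilon>. Up to exp
  (\<epsilon> N), the walk is then uniformly distributed.\<close>

lemma abs_moment_mixed:
  assumes "\<epsilon> > 0"
  shows "\<exists>K\<ge>1. \<forall>N\<ge>1. abs_moment N (K * N) \<le> 2 * real N ^ (K * N) * (exp (\<epsilon> * real N) / 2 ^ N)"
proof -
  obtain K0 :: nat where "1 / \<epsilon> < real K0" using reals_Archimedean2 by blast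
  define K where "K = max 1 K0"
  have K: "K \<ge> 1" "1 / \<epsilon> < real K" using \<open>1 / \<epsilon> < real K0\<close> by (auto simp: K_def)
  have "exp (- 2 * real K) \<le> \<epsilon>"
  proof -
    have "1 < \<epsilon> * real K" using K assms by (simp add: field_simps)
    also have "\<dots> \<le> \<epsilon> * exp (2 * real K)"
    proof (intro mult_left_mono)
      show "real K \<le> exp (2 * real K)"
        using exp_ge_add_one_self[of "2 * real K"] by linarith
    qed (use assms in simp)
    finally show ?thesis by (simp add: exp_minus field_simps)
  qed
  have "abs_moment N (K * N) \<le> 2 * real N ^ (K * N) * (exp (\<epsilon> * real N) / 2 ^ N)" if N: "N \<ge> 1" for N
  proof -
    have "(1 + exp (- 2 * real K)) ^ N \<le> exp \<epsilon> ^ N"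
    proof (rule power_mono)
      show "1 + exp (- 2 * real K) \<le> exp \<epsilon>"
        using exp_ge_add_one_self[of \<epsilon>] \<open>exp (- 2 * real K) \<le> \<epsilon>\<close> by linarith
    qed (simp add: add_nonneg_nonneg)
    then have "2 * real N ^ (K * N) * ((1 + exp (- 2 * real K)) ^ N / 2 ^ N)
        \<le> 2 * real N ^ (K * N) * (exp \<epsilon> ^ N / 2 ^ N)"
      by (intro mult_left_mono divide_right_mono) auto
    moreover have "- 2 * real (K * N) / real N = - 2 * real K" using N by simp
    ultimately show ?thesis using abs_moment_le_mixing[OF N, of "K * N"]
      by (simp add: power_divide exp_of_nat_mult[symmetric] mult.commute)
  qed
  then show ?thesis using K(1) by blast
qed

section \<open>Growth of the number of words with bounded memory\<close>

lemma sum_geometric_le: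
  fixes x :: real
  assumes "0 \<le> x" "x < 1"
  shows "(\<Sum>i=a..b. x ^ i) \<le> x ^ a / (1 - x)"
proof (cases "a \<le> b")
  case True
  have "(\<Sum>i=a..b. x ^ i) = (x ^ a - x ^ Suc b) / (1 - x)"
    using sum_gp[of x a b] True assms by simp
  also have "\<dots> \<le> x ^ a / (1 - x)"
    using assms by (intro divide_right_mono) auto
  finally show ?thesis .
qed (use assms in auto)

text \<open>Closed words of length \<open>m\<close> are compared with
  \<open>(real N - h) ^ m\<close> instead of N^m, because \<open>real N - h\<close> is the growth
  rate that can be proved from below: a closed piece that is cut out is paid for by this growth. The
  value of \<open>h\<close> is the one for which the induction in \<open>num_awords_Suc_ge\<close>
  closes.\<close>

locale few_loops =
  fixes N L :: nat and B x h :: real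
  assumes x: "0 < x" "x < 1"
    and B: "0 < B"
    and h_def: "h = B / (1 - x)"
    and h_le: "2 * h \<le> real N"
    and loops_le: "\<And>m. 2 \<le> m \<Longrightarrow> m \<le> L \<Longrightarrow>
      real (card (loops N m)) \<le> B / real N * x ^ m * (real N - h) ^ m"
begin

text \<open>The bound for the proportion of pairs of admissible words whose concatenation fails: the
  double geometric series over the two parts of a straddling closed word. It is O(1/N).\<close>

definition \<tau> :: real
  where "\<tau> = B / real N / (1 - x)\<^sup>2"

lemma h_pos: "0 < h"
  using x B by (simp add: h_def)

lemma N_gt_0: "0 < real N"
  using h_pos h_le by linarith

lemma N_minus_h_gt_0: "0 < real N - h"
  using h_pos h_le by linarith

lemma N_minus_h_ge_half: "real N / 2 \<le> real N - h"
  using h_le by linarith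

lemmas N_pos = N_gt_0 N_minus_h_gt_0 N_minus_h_ge_half

lemma \<tau>_nonneg: "0 \<le> \<tau>"
  using x B N_pos by (simp add: \<tau>_def)

text \<open>A forbidden extension by one letter closes a suffix of some length \<open>i + 1\<close>.
  By the induction hypothesis, removing \<open>i\<close> letters divides the count by at least
  \<open>(real N - h) ^ i\<close>, so these extensions form a geometric series with sum at most
  \<open>h\<close> times the count.\<close>

lemma num_awords_Suc_ge:
  assumes D: "D \<le> L"
  shows "(real N - h) * num_awords N D n \<le> num_awords N D (Suc n)"
proof (induction n rule: less_induct)
  case (less n)
  let ?R = "real N - h"
  have step_back: "?R ^ i * num_awords N D (n - i) \<le> num_awords N D n" if "i \<le> n" for i
    using that
  proof (induction i)
    case (Suc i)
    have "?R * num_awords N D (n - Suc i) \<le> num_awords N D (Suc (n - Suc i))"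
      using Suc.prems by (intro less) auto
    then have "?R ^ i * (?R * num_awords N D (n - Suc i)) \<le> ?R ^ i * num_awords N D (n - i)"
      using N_pos Suc.prems by (intro mult_left_mono) (auto simp: Suc_diff_Suc)
    then show ?case using Suc by (simp add: mult_ac)
  qed simp
  have "real (card (fails N D n 1)) \<le>
     (\<Sum>i=1..n. if i + 1 \<le> D then num_awords N D (n - i) * real (card (loops N (i + 1))) else 0)"
    using card_fails_le[of N D n 1] by (simp add: num_awords_0 cong: if_cong)
  also have "\<dots> \<le> (\<Sum>i=1..n. num_awords N D n * B * x ^ i)"
  proof (rule sum_mono)
    fix i assume i: "i \<in> {1..n}"
    show "(if i + 1 \<le> D then num_awords N D (n - i) * real (card (loops N (i + 1))) else 0)
        \<le> num_awords N D n * B * x ^ i"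
    proof (cases "i + 1 \<le> D")
      case True
      have "num_awords N D (n - i) * real (card (loops N (i + 1))) \<le>
          num_awords N D (n - i) * (B / real N * x ^ (i + 1) * ?R ^ (i + 1))"
        using True D i by (intro mult_left_mono loops_le) auto
      also have "\<dots> = (?R ^ i * num_awords N D (n - i)) * (B * x ^ i * (x * (?R / real N)))"
        by (simp add: field_simps)
      also have "\<dots> \<le> num_awords N D n * (B * x ^ i * (1 * 1))"
        using x B N_pos h_pos i by (intro mult_mono step_back) auto
      finally show ?thesis using True by simp
    qed (use x B in simp)
  qed
  also have "\<dots> = num_awords N D n * B * (\<Sum>i=1..n. x ^ i)"
    by (simp add: sum_distrib_left)
  also have "\<dots> \<le> num_awords N D n * B * (x ^ 1 / (1 - x))"
    using x B by (intro mult_left_mono sum_geometric_le) auto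
  also have "\<dots> \<le> num_awords N D n * h"
    using x B by (simp add: h_def divide_simps mult_left_le mult_nonneg_nonneg)
  finally have "num_awords N D n * real N - num_awords N D (n + 1) \<le> num_awords N D n * h"
    unfolding card_fails_eq num_awords_1 .
  then show ?case by (simp add: algebra_simps)
qed

lemma num_awords_Suc_le: "num_awords N D (Suc n) \<le> real N * num_awords N D n"
  using num_awords_add_le[of N D n 1] by (simp add: num_awords_1[unfolded One_nat_def] mult.commute)

lemma num_awords_minus_le:
  assumes "D \<le> L" "i \<le> n"
  shows "(real N - h) ^ i * num_awords N D (n - i) \<le> num_awords N D n"
  using assms(2)
proof (induction i)
  case (Suc i)
  have "(real N - h) * num_awords N D (n - Suc i) \<le> num_awords N D (Suc (n - Suc i))"
    by (rule num_awords_Suc_ge[OF assms(1)])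
  then have "(real N - h) ^ i * ((real N - h) * num_awords N D (n - Suc i)) \<le> (real N - h) ^ i * num_awords N D (n - i)"
    using N_pos Suc.prems by (intro mult_left_mono) (auto simp: Suc_diff_Suc)
  then show ?case using Suc by (simp add: mult_ac)
qed simp

lemma num_awords_pos:
  assumes "D \<le> L"
  shows "0 < num_awords N D n"
proof -
  have "0 < (real N - h) ^ n" using N_pos by simp
  then show ?thesis using num_awords_minus_le[OF assms order_refl, of n] by (simp add: num_awords_0)
qed

text \<open>A straddling closed word with parts \<open>i\<close> and \<open>j\<close> has relative
  weight at most \<open>B / real N * x ^ (i + j)\<close>. Summing over both parts gives a bound that
  does not depend on the lengths \<open>a\<close> and \<open>b\<close>.\<close>

lemma card_fails_le_tau:
  assumes D: "D \<le> L"
  shows "real (card (fails N D a b)) \<le> \<tau> * (num_awords N D a * num_awords N D b)"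
proof -
  let ?R = "real N - h"
  have "real (card (fails N D a b)) \<le> (\<Sum>i=1..a. \<Sum>j=1..b. if i + j \<le> D
       then num_awords N D (a - i) * real (card (loops N (i + j))) * num_awords N D (b - j) else 0)"
    by (rule card_fails_le)
  also have "\<dots> \<le> (\<Sum>i=1..a. \<Sum>j=1..b. (num_awords N D a * num_awords N D b * (B / real N)) * (x ^ i * x ^ j))"
  proof (intro sum_mono)
    fix i j assume ij: "i \<in> {1..a}" "j \<in> {1..b}"
    show "(if i + j \<le> D then num_awords N D (a - i) * real (card (loops N (i + j))) * num_awords N D (b - j) else 0)
      \<le> (num_awords N D a * num_awords N D b * (B / real N)) * (x ^ i * x ^ j)"
    proof (cases "i + j \<le> D")
      case True
      have "num_awords N D (a - i) * real (card (loops N (i + j))) * num_awords N D (b - j) \<le>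
          num_awords N D (a - i) * (B / real N * x ^ (i + j) * ?R ^ (i + j)) * num_awords N D (b - j)"
        using True D ij by (intro mult_left_mono mult_right_mono loops_le) auto
      also have "\<dots> = (?R ^ i * num_awords N D (a - i)) * (?R ^ j * num_awords N D (b - j)) * (B / real N * (x ^ i * x ^ j))"
        by (simp add: power_add mult_ac)
      also have "\<dots> \<le> num_awords N D a * num_awords N D b * (B / real N * (x ^ i * x ^ j))"
        using x B N_pos ij D by (intro mult_mono num_awords_minus_le mult_right_mono mult_nonneg_nonneg) auto
      finally show ?thesis using True by (simp add: mult_ac)
    qed (use x B in simp)
  qed
  also have "\<dots> = num_awords N D a * num_awords N D b * (B / real N) * ((\<Sum>i=1..a. x ^ i) * (\<Sum>j=1..b. x ^ j))"
    by (simp only: sum_distrib_left[symmetric] sum_product)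
  also have "\<dots> \<le> num_awords N D a * num_awords N D b * (B / real N) * ((x ^ 1 / (1 - x)) * (x ^ 1 / (1 - x)))"
    using x B by (intro mult_left_mono mult_mono sum_geometric_le) (auto intro!: sum_nonneg)
  also have "\<dots> \<le> num_awords N D a * num_awords N D b * (B / real N) * ((1 / (1 - x)) * (1 / (1 - x)))"
    using x B by (intro mult_left_mono mult_mono divide_right_mono) auto
  finally show ?thesis by (simp add: \<tau>_def power2_eq_square mult_ac)
qed

section \<open>Approximate supermultiplicativity and the effect of a longer memory\<close>

lemma num_awords_mult_le:
  assumes "D \<le> L" "\<tau> \<le> 1 / 2"
  shows "num_awords N D a * num_awords N D b \<le> 2 * num_awords N D (a + b)"
proof -
  have "num_awords N D a * num_awords N D b - num_awords N D (a + b) \<le> \<tau> * (num_awords N D a * num_awords N D b)"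
    using card_fails_le_tau[OF assms(1), of a b] by (simp only: card_fails_eq)
  moreover have "\<tau> * (num_awords N D a * num_awords N D b) \<le> 1 / 2 * (num_awords N D a * num_awords N D b)"
    using assms(2) by (intro mult_right_mono) auto
  ultimately show ?thesis by linarith
qed

lemma num_awords_power_mult_le:
  assumes "D \<le> L" "\<tau> \<le> 1 / 2"
  shows "num_awords N D d ^ s * num_awords N D k \<le> 2 ^ s * num_awords N D (k + s * d)"
proof (induction s)
  case (Suc s)
  have "num_awords N D d ^ Suc s * num_awords N D k = num_awords N D d * (num_awords N D d ^ s * num_awords N D k)" by simp
  also have "\<dots> \<le> num_awords N D d * (2 ^ s * num_awords N D (k + s * d))"
    by (intro mult_left_mono Suc) auto
  also have "\<dots> = 2 ^ s * (num_awords N D d * num_awords N D (k + s * d))" by simp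
  also have "\<dots> \<le> 2 ^ s * (2 * num_awords N D (d + (k + s * d)))"
    by (intro mult_left_mono num_awords_mult_le assms) auto
  finally show ?case by (simp add: add_ac)
qed simp

text \<open>A word lost by raising the memory contains a closed subword of length between
  \<open>D + 1\<close> and \<open>D'\<close>. There are at most \<open>n + 1\<close> starting
  positions; cutting it out and joining the rest costs a factor 2, and the lengths sum to a
  geometric tail.\<close>

lemma num_awords_memory_diff_le:
  assumes D: "D \<le> D'" "D' \<le> L" "\<tau> \<le> 1 / 2"
  shows "num_awords N D n - num_awords N D' n \<le> 2 * real (Suc n) * (B / real N * (x ^ Suc D / (1 - x))) * num_awords N D n"
proof -
  let ?R = "real N - h"
  define I where "I = {D<..D'} \<inter> {..n}"
  define X where "X m a = awords N D a \<times> loops N m \<times> awords N D (n - m - a)" for m a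
  have finX: "finite (X m a)" for m a by (simp add: X_def)
  have sub: "awords N D' n \<subseteq> awords N D n"
    using D(1) by (auto simp: awords_def avoiding_def)
  have "awords N D n - awords N D' n \<subseteq>
      (\<Union>(m, a)\<in>I \<times> {..n}. (\<lambda>(p, l, q). p @ l @ q) ` (if a + m \<le> n then X m a else {}))"
  proof
    fix w assume w: "w \<in> awords N D n - awords N D' n"
    then obtain y where y: "sublist y w" "y \<noteq> []" "odd_letters y = {}" "length y \<le> D'"
      by (auto simp: awords_def avoiding_def not_less)
    then have "D < length y" using w by (auto simp: awords_def avoiding_def)
    obtain p q where pq: "w = p @ y @ q" using y(1) by (auto simp: sublist_def)
    have "p \<in> awords N D (length p)" "q \<in> awords N D (length q)" "y \<in> loops N (length y)"
      using w y pq avoiding_sublist[of D w p] avoiding_sublist[of D w q]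
      by (auto simp: awords_def loops_def sublist_append)
    moreover have "length p + length y + length q = n" using w pq by (auto simp: awords_def)
    ultimately have "(p, y, q) \<in> X (length y) (length p)" "length p + length y \<le> n"
      "(length y, length p) \<in> I \<times> {..n}"
      using \<open>D < length y\<close> y(4) by (auto simp: X_def I_def)
    then show "w \<in> (\<Union>(m, a)\<in>I \<times> {..n}. (\<lambda>(p, l, q). p @ l @ q) ` (if a + m \<le> n then X m a else {}))"
      using pq by (intro UN_I[of "(length y, length p)"]) (auto simp: image_iff intro!: bexI[of _ "(p, y, q)"])
  qed
  then have "card (awords N D n - awords N D' n) \<le>
      card (\<Union>(m, a)\<in>I \<times> {..n}. (\<lambda>(p, l, q). p @ l @ q) ` (if a + m \<le> n then X m a else {}))"
    by (intro card_mono) (auto simp: X_def I_def)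
  also have "\<dots> \<le> (\<Sum>(m, a)\<in>I \<times> {..n}. card ((\<lambda>(p, l, q). p @ l @ q) ` (if a + m \<le> n then X m a else {})))"
    using card_UN_le[of "I \<times> {..n}" "\<lambda>(m, a). (\<lambda>(p, l, q). p @ l @ q) ` (if a + m \<le> n then X m a else {})"]
    by (simp add: case_prod_unfold I_def)
  also have "\<dots> \<le> (\<Sum>(m, a)\<in>I \<times> {..n}. if a + m \<le> n then card (X m a) else 0)"
    by (intro sum_mono, clarify) (simp add: card_image_le[OF finX])
  finally have "real (card (awords N D n - awords N D' n)) \<le>
      real (\<Sum>(m, a)\<in>I \<times> {..n}. if a + m \<le> n then card (X m a) else 0)"
    by (simp only: of_nat_le_iff)
  also have "\<dots> = (\<Sum>m\<in>I. \<Sum>a\<le>n. if a + m \<le> n then real (card (X m a)) else 0)"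
    by (simp add: sum.cartesian_product case_prod_unfold if_distrib[of real] cong: if_cong)
  also have "\<dots> \<le> (\<Sum>m\<in>I. \<Sum>a\<le>n. 2 * (B / real N) * num_awords N D n * x ^ m)"
  proof (intro sum_mono)
    fix m a assume ma: "m \<in> I" "a \<in> {..n}"
    show "(if a + m \<le> n then real (card (X m a)) else 0) \<le> 2 * (B / real N) * num_awords N D n * x ^ m"
    proof (cases "a + m \<le> n \<and> 2 \<le> m")
      case True
      have "real (card (X m a)) = (num_awords N D a * num_awords N D (n - m - a)) * real (card (loops N m))"
        by (simp add: X_def num_awords_def)
      also have "\<dots> \<le> (2 * num_awords N D (a + (n - m - a))) * (B / real N * x ^ m * ?R ^ m)"
        using True ma D by (intro mult_mono num_awords_mult_le loops_le) (auto simp: I_def)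
      also have "a + (n - m - a) = n - m" using True by auto
      also have "2 * num_awords N D (n - m) * (B / real N * x ^ m * ?R ^ m) =
          (?R ^ m * num_awords N D (n - m)) * (2 * (B / real N) * x ^ m)" by simp
      also have "\<dots> \<le> num_awords N D n * (2 * (B / real N) * x ^ m)"
        using True D x B by (intro mult_right_mono num_awords_minus_le) auto
      finally show ?thesis using True by (simp add: mult_ac)
    next
      case False
      \<comment> \<open>The density bound of the locale starts at length 2; length 1 can only occur
        for \<open>D = 0\<close>, and then there is no closed word.\<close>
      have "loops N 1 = {}"
        by (auto simp: loops_def length_Suc_conv odd_letters_Cons)
      moreover have "m = 1" if "a + m \<le> n" using False that ma by (auto simp: I_def)
      ultimately show ?thesis using x B by (auto simp: X_def)
    qed
  qed
  also have "\<dots> = 2 * real (Suc n) * (B / real N) * num_awords N D n * (\<Sum>m\<in>I. x ^ m)"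
    by (simp only: sum_constant card_atMost sum_distrib_left) (simp only: mult_ac)
  also have "\<dots> \<le> 2 * real (Suc n) * (B / real N) * num_awords N D n * (x ^ Suc D / (1 - x))"
  proof (rule mult_left_mono)
    have "(\<Sum>m\<in>I. x ^ m) \<le> (\<Sum>m=Suc D..D'. x ^ m)"
      using x by (intro sum_mono2) (auto simp: I_def)
    also have "\<dots> \<le> x ^ Suc D / (1 - x)"
      using x by (intro sum_geometric_le) auto
    finally show "(\<Sum>m\<in>I. x ^ m) \<le> x ^ Suc D / (1 - x)" .
  qed (use B in simp)
  finally have "real (card (awords N D n - awords N D' n)) \<le>
      2 * real (Suc n) * (B / real N) * num_awords N D n * (x ^ Suc D / (1 - x))" .
  moreover have "real (card (awords N D n - awords N D' n)) = num_awords N D n - num_awords N D' n"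
    using sub by (simp add: num_awords_def card_Diff_subset card_mono of_nat_diff)
  ultimately show ?thesis by (simp add: mult_ac)
qed

lemma num_awords_antimono: "D \<le> D' \<Longrightarrow> num_awords N D' n \<le> num_awords N D n"
  unfolding num_awords_def
  by (intro of_nat_mono card_mono finite_awords) (auto simp: awords_def avoiding_def)

end

section \<open>Exchanging tails\<close>

text \<open>
  The first word is cut one letter later, so that lengths \<open>n + 2\<close> and \<open>n\<close> become \<open>n + 1\<close> and
  \<open>n + 1\<close>. The cut points are odd multiples of \<open>D\<close>: each sits in the middle of its own block
  of length \<open>2 * D\<close>, and exchanging tails there does not affect the earlier ones.
\<close>

definition swap_tails :: "nat \<Rightarrow> nat list \<times> nat list \<Rightarrow> nat list \<times> nat list"
  where "swap_tails j = (\<lambda>(u, v). (take (Suc j) u @ drop j v, take j v @ drop (Suc j) u))"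

definition swappable :: "nat \<Rightarrow> nat \<Rightarrow> nat list \<times> nat list \<Rightarrow> bool"
  where "swappable D j z \<longleftrightarrow> avoiding D (fst (swap_tails j z)) \<and> avoiding D (snd (swap_tails j z))"

definition stuck :: "nat \<Rightarrow> nat \<Rightarrow> nat list \<times> nat list \<Rightarrow> bool"
  where "stuck D r z \<longleftrightarrow> (\<forall>w<r. \<not> swappable D ((2 * w + 1) * D) z)"

definition stuck_pairs :: "nat \<Rightarrow> nat \<Rightarrow> nat \<Rightarrow> nat \<Rightarrow> nat \<Rightarrow> (nat list \<times> nat list) set"
  where "stuck_pairs N D r n m = {z \<in> awords N D n \<times> awords N D m. stuck D r z}"

definition stuck_blocks :: "nat \<Rightarrow> nat \<Rightarrow> (nat list \<times> nat list) set"
  where "stuck_blocks N D = {(b, b'). b \<in> awords N D (2 * D) \<and> b' \<in> awords N D (2 * D) \<and>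
    \<not> (avoiding D (take D b @ drop D b') \<and> avoiding D (take D b' @ drop D b))}"

lemma finite_stuck_pairs [simp]: "finite (stuck_pairs N D r n m)"
  unfolding stuck_pairs_def by (rule finite_subset[of _ "awords N D n \<times> awords N D m"]) auto

lemma finite_stuck_blocks [simp]: "finite (stuck_blocks N D)"
  unfolding stuck_blocks_def
  by (rule finite_subset[of _ "awords N D (2 * D) \<times> awords N D (2 * D)"]) auto

lemma drop_split: "i \<le> j \<Longrightarrow> j \<le> length w \<Longrightarrow> drop i w = drop i (take j w) @ drop j w"
  using drop_append[of i "take j w" "drop j w"] by simp

lemma inj_on_split_pair:
  "inj_on (\<lambda>(u, v). ((take a u, take b v), (drop a u, drop b v))) X"
  by (rule inj_on_inverseI[where g = "\<lambda>((p, q), (r, s)). (p @ r, q @ s)"]) auto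

lemma inj_on_split_cross:
  "inj_on (\<lambda>(b, b'). ((take D b, drop D b'), (take D b', drop D b))) X"
  by (rule inj_on_inverseI[where g = "\<lambda>((p, q), (r, s)). (p @ s, r @ q)"]) force

lemma inj_on_split_cross':
  "inj_on (\<lambda>(b, b'). ((take D b', drop D b), (take D b, drop D b'))) X"
  by (rule inj_on_inverseI[where g = "\<lambda>((p, q), (r, s)). (r @ q, p @ s)"]) force

text \<open>Only the \<open>D\<close> letters after the cut interact with the new left part. Used in
  contrapositive form: a pair that cannot be exchanged remains so after its far ends are cut
  off.\<close>

lemma swappable_truncate:
  assumes "avoiding D u" "avoiding D v"
    and "Suc j + D \<le> a" "a \<le> length u" "j + D \<le> b" "b \<le> length v"
    and "swappable D j (take a u, take b v)"
  shows "swappable D j (u, v)"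
proof -
  have 1: "take (Suc j) (take a u) = take (Suc j) u" "take j (take b v) = take j v"
    using assms by (auto simp: min_def)
  have 2: "drop j v = drop j (take b v) @ drop b v" "drop (Suc j) u = drop (Suc j) (take a u) @ drop a u"
    using assms by (auto intro!: drop_split)
  have "avoiding D (drop j (take b v) @ drop b v)" "avoiding D (drop (Suc j) (take a u) @ drop a u)"
    using assms avoiding_drop 2 by metis+
  moreover have "D \<le> length (drop j (take b v))" "D \<le> length (drop (Suc j) (take a u))"
    using assms by auto
  ultimately have "avoiding D (take (Suc j) u @ drop j (take b v) @ drop b v)"
    "avoiding D (take j v @ drop (Suc j) (take a u) @ drop a u)"
    using assms(7) avoiding_append_iff
    by (auto simp only: swappable_def swap_tails_def 1 case_prod_conv fst_conv snd_conv)
  then show ?thesis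
    by (simp only: swappable_def swap_tails_def 2 case_prod_conv fst_conv snd_conv)
qed

lemma stuck_truncate:
  assumes "avoiding D u" "avoiding D v" "stuck D r (u, v)"
    and "2 * r * D + 1 \<le> a" "a \<le> length u" "2 * r * D \<le> b" "b \<le> length v"
  shows "stuck D r (take a u, take b v)"
  unfolding stuck_def
proof (intro allI impI)
  fix w assume w: "w < r"
  then have "2 * w + 2 \<le> 2 * r" by simp
  then have "(2 * w + 2) * D \<le> 2 * r * D" by (rule mult_le_mono1)
  then have "(2 * w + 1) * D + D \<le> 2 * r * D" by (simp add: algebra_simps)
  then have "swappable D ((2 * w + 1) * D) (take a u, take b v) \<Longrightarrow> swappable D ((2 * w + 1) * D) (u, v)"
    using assms by (intro swappable_truncate[of D u v _ a b]) auto
  then show "\<not> swappable D ((2 * w + 1) * D) (take a u, take b v)"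
    using assms(3) w by (auto simp: stuck_def)
qed

text \<open>The left halves of the two blocks have length \<open>D\<close> and shield everything
  before them, so the success of the exchange can be read off from the blocks alone. A stuck cut
  point therefore forces its two blocks into \<open>stuck_blocks\<close>.\<close>

lemma swappable_of_block:
  assumes "avoiding D u" "avoiding D v" "length u = k + 1 + 2 * D" "length v = k + 2 * D"
    and "avoiding D (take D (drop (k + 1) u) @ drop D (drop k v))"
    and "avoiding D (take D (drop k v) @ drop D (drop (k + 1) u))"
  shows "swappable D (k + D) (u, v)"
proof -
  have u: "take (Suc (k + D)) u = take (k + 1) u @ take D (drop (k + 1) u)"
    using take_add[of "k + 1" D u] by simp
  have v: "take (k + D) v = take k v @ take D (drop k v)"
    by (rule take_add)
  have d: "drop (k + D) v = drop D (drop k v)" "drop (Suc (k + D)) u = drop D (drop (k + 1) u)"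
    by (simp_all add: add_ac)
  have "avoiding D (take (k + 1) u @ take D (drop (k + 1) u) @ drop D (drop k v))"
    by (rule avoiding_append_iff[THEN iffD2])
      (use assms u avoiding_take[of D u "Suc (k + D)"] in auto)
  moreover have "avoiding D (take k v @ take D (drop k v) @ drop D (drop (k + 1) u))"
    by (rule avoiding_append_iff[THEN iffD2])
      (use assms v avoiding_take[of D v "k + D"] in auto)
  ultimately show ?thesis
    by (simp only: swappable_def swap_tails_def u v d case_prod_conv fst_conv snd_conv append_assoc)
qed

lemma card_stuck_pairs_le_truncated:
  assumes "2 * r * D + 1 \<le> n" "2 * r * D \<le> m"
  shows "card (stuck_pairs N D r n m) \<le> card (stuck_pairs N D r (2 * r * D + 1) (2 * r * D)) *
    (card (awords N D (n - (2 * r * D + 1))) * card (awords N D (m - 2 * r * D)))"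
proof -
  let ?a = "2 * r * D + 1" and ?b = "2 * r * D"
  let ?f = "\<lambda>(u, v). ((take ?a u, take ?b v), (drop ?a u, drop ?b v))"
  have "card (stuck_pairs N D r n m) \<le> card (stuck_pairs N D r ?a ?b \<times>
      (awords N D (n - ?a) \<times> awords N D (m - ?b)))"
  proof (rule card_inj_on_le[OF inj_on_split_pair])
    show "?f ` stuck_pairs N D r n m \<subseteq> stuck_pairs N D r ?a ?b \<times>
      (awords N D (n - ?a) \<times> awords N D (m - ?b))"
    proof (rule image_subsetI)
      fix z assume z: "z \<in> stuck_pairs N D r n m"
      obtain u v where zuv: "z = (u, v)" by force
      have "(u, v) \<in> stuck_pairs N D r n m" using z zuv by simp
      then have uv: "u \<in> awords N D n" "v \<in> awords N D m" "stuck D r (u, v)"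
        by (auto simp: stuck_pairs_def)
      have "u \<in> awords N D (?a + (n - ?a))" "v \<in> awords N D (?b + (m - ?b))"
        using assms uv by auto
      note awords_split[OF this(1)] awords_split[OF this(2)]
      moreover have "stuck D r (take ?a u, take ?b v)"
        using assms uv by (intro stuck_truncate) (auto simp: awords_def)
      ultimately show "?f z \<in>
        stuck_pairs N D r ?a ?b \<times> (awords N D (n - ?a) \<times> awords N D (m - ?b))"
        by (simp add: stuck_pairs_def zuv)
    qed
  qed simp
  then show ?thesis by (simp add: card_cartesian_product)
qed

text \<open>Peeling off the last pair of blocks: each stuck cut point constrains its own pair of
  blocks, which gives a product bound. The factor \<open>card (awords N D 1)\<close> counts the
  first letter of the longer word, the offset between the two cuts.\<close>

lemma card_stuck_pairs_base:
  "card (stuck_pairs N D r (2 * r * D + 1) (2 * r * D)) \<le> card (awords N D 1) * card (stuck_blocks N D) ^ r"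
proof (induction r)
  case 0
  have "card (stuck_pairs N D 0 1 0) \<le> card (awords N D 1 \<times> awords N D 0)"
    by (rule card_mono) (auto simp: stuck_pairs_def)
  moreover have "awords N D 0 = {[]}" by (auto simp: awords_def)
  ultimately show ?case by (simp add: card_cartesian_product)
next
  case (Suc r)
  let ?a = "2 * r * D + 1" and ?b = "2 * r * D"
  let ?f = "\<lambda>(u, v). ((take ?a u, take ?b v), (drop ?a u, drop ?b v))"
  have len: "2 * Suc r * D + 1 = ?a + 2 * D" "2 * Suc r * D = ?b + 2 * D"
    by (simp_all add: algebra_simps)
  have "card (stuck_pairs N D (Suc r) (?a + 2 * D) (?b + 2 * D)) \<le>
      card (stuck_pairs N D r ?a ?b \<times> stuck_blocks N D)"
  proof (rule card_inj_on_le[OF inj_on_split_pair])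
    show "?f ` stuck_pairs N D (Suc r) (?a + 2 * D) (?b + 2 * D) \<subseteq>
      stuck_pairs N D r ?a ?b \<times> stuck_blocks N D"
    proof (rule image_subsetI)
      fix z assume z: "z \<in> stuck_pairs N D (Suc r) (?a + 2 * D) (?b + 2 * D)"
      obtain u v where zuv: "z = (u, v)" by force
      have "(u, v) \<in> stuck_pairs N D (Suc r) (?a + 2 * D) (?b + 2 * D)" using z zuv by simp
      then have uv: "u \<in> awords N D (?a + 2 * D)" "v \<in> awords N D (?b + 2 * D)" "stuck D (Suc r) (u, v)"
        by (auto simp: stuck_pairs_def)
      have "stuck D r (u, v)" using uv by (auto simp: stuck_def)
      then have "stuck D r (take ?a u, take ?b v)"
        using uv by (intro stuck_truncate) (auto simp: awords_def)
      \<comment> \<open>The last cut point \<open>(2 * r + 1) * D\<close> is the middle of the last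
        block.\<close>
      moreover have "\<not> swappable D (?b + D) (u, v)"
        using uv(3) by (auto simp: stuck_def algebra_simps dest: spec[of _ r])
      then have "\<not> (avoiding D (take D (drop ?a u) @ drop D (drop ?b v)) \<and>
          avoiding D (take D (drop ?b v) @ drop D (drop ?a u)))"
        using uv swappable_of_block[of D u v ?b] by (auto simp: awords_def)
      moreover note awords_split[OF uv(1)] awords_split[OF uv(2)]
      ultimately show "?f z \<in>
        stuck_pairs N D r ?a ?b \<times> stuck_blocks N D"
        by (simp add: stuck_pairs_def stuck_blocks_def zuv)
    qed
  qed simp
  also have "\<dots> = card (stuck_pairs N D r ?a ?b) * card (stuck_blocks N D)"
    by (rule card_cartesian_product)
  also have "\<dots> \<le> card (awords N D 1) * card (stuck_blocks N D) ^ r * card (stuck_blocks N D)"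
    by (rule mult_le_mono1[OF Suc.IH])
  finally show ?case unfolding len by (simp add: mult_ac)
qed

section \<open>Classifying pairs by their first cut point that allows an exchange\<close>

definition first_swappable :: "nat \<Rightarrow> nat \<Rightarrow> nat \<Rightarrow> nat \<Rightarrow> nat \<Rightarrow> (nat list \<times> nat list) set"
  where "first_swappable N D w n m = {z \<in> awords N D n \<times> awords N D m.
    swappable D ((2 * w + 1) * D) z \<and> stuck D w z}"

lemma finite_first_swappable [simp]: "finite (first_swappable N D w n m)"
  unfolding first_swappable_def by (rule finite_subset[of _ "awords N D n \<times> awords N D m"]) auto

lemma swap_tails_swap_tails:
  assumes "Suc j \<le> length u" "j \<le> length v"
  shows "swap_tails j (swap_tails j (u, v)) = (u, v)"
  using assms by (simp add: swap_tails_def min_def)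

text \<open>Between the two cuts each word has at least \<open>D\<close> letters, so by
  \<open>avoiding_append_iff\<close> the conditions at the cut \<open>i\<close> split into a part
  left of \<open>j\<close>, which the exchange leaves alone, and parts that hold both before and
  after it. Hence the exchange preserves which cut point is the first good one.\<close>

lemma swappable_swap_tails:
  assumes "avoiding D u" "avoiding D v" "Suc j \<le> length u" "j \<le> length v"
    and "swappable D j (u, v)" and i: "i + D \<le> j"
  shows "swappable D i (swap_tails j (u, v)) \<longleftrightarrow> swappable D i (u, v)"
proof -
  define q where "q = drop i (take j v)"
  define q' where "q' = drop (Suc i) (take (Suc j) u)"
  have len: "D \<le> length q" "D \<le> length q'" using assms by (auto simp: q_def q'_def)
  have v: "drop i v = q @ drop j v" "drop i (take j v @ drop (Suc j) u) = q @ drop (Suc j) u"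
    using assms drop_split[of i j v] by (auto simp: q_def)
  have u: "drop (Suc i) u = q' @ drop (Suc j) u"
    "drop (Suc i) (take (Suc j) u @ drop j v) = q' @ drop j v"
    using assms drop_split[of "Suc i" "Suc j" u] by (auto simp: q'_def)
  have t: "take (Suc i) (take (Suc j) u @ drop j v) = take (Suc i) u"
    "take i (take j v @ drop (Suc j) u) = take i v"
    using assms by (auto simp: min_def)
  have "avoiding D (q @ drop (Suc j) u)" "avoiding D (q' @ drop j v)"
    "avoiding D (q @ drop j v)" "avoiding D (q' @ drop (Suc j) u)"
    using assms avoiding_drop u v unfolding swappable_def swap_tails_def
    by (metis (no_types, lifting) case_prod_conv fst_conv snd_conv)+
  then show ?thesis
    unfolding swappable_def swap_tails_def case_prod_conv fst_conv snd_conv u v t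
    by (simp add: avoiding_append_iff[OF len(1)] avoiding_append_iff[OF len(2)])
qed

text \<open>\<open>swap_tails\<close> is its own inverse, so it is injective, and it turns lengths
  \<open>n\<close> and \<open>m\<close> into \<open>m + 1\<close> and \<open>n - 1\<close>.\<close>

lemma card_first_swappable_le:
  assumes "(2 * w + 1) * D < n" "(2 * w + 1) * D \<le> m"
  shows "card (first_swappable N D w n m) \<le> card (first_swappable N D w (m + 1) (n - 1))"
proof (rule card_inj_on_le)
  let ?j = "(2 * w + 1) * D"
  show "inj_on (swap_tails ?j) (first_swappable N D w n m)"
  proof (rule inj_on_inverseI)
    fix z assume "z \<in> first_swappable N D w n m"
    then show "swap_tails ?j (swap_tails ?j z) = z"
      using assms by (cases z) (auto simp: first_swappable_def awords_def intro!: swap_tails_swap_tails)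
  qed
  show "swap_tails ?j ` first_swappable N D w n m \<subseteq> first_swappable N D w (m + 1) (n - 1)"
  proof (rule image_subsetI)
    fix z assume z: "z \<in> first_swappable N D w n m"
    obtain u v where zuv: "z = (u, v)" by force
    have "(u, v) \<in> first_swappable N D w n m" using z zuv by simp
    then have uv: "u \<in> awords N D n" "v \<in> awords N D m" "swappable D ?j (u, v)" "stuck D w (u, v)"
      by (auto simp: first_swappable_def)
    have len: "Suc ?j \<le> length u" "?j \<le> length v" and av: "avoiding D u" "avoiding D v"
      using uv assms by (auto simp: awords_def)
    have "fst (swap_tails ?j (u, v)) \<in> awords N D (m + 1)" "snd (swap_tails ?j (u, v)) \<in> awords N D (n - 1)"
      using uv assms
      by (auto simp: swappable_def swap_tails_def awords_def dest!: in_set_takeD in_set_dropD)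
    moreover have "swappable D ?j (swap_tails ?j (u, v))"
      using av unfolding swappable_def swap_tails_swap_tails[OF len] by simp
    moreover have "stuck D w (swap_tails ?j (u, v))"
      unfolding stuck_def
    proof (intro allI impI)
      fix w' assume w': "w' < w"
      then have "2 * w' + 2 \<le> 2 * w + 1" by simp
      then have "(2 * w' + 2) * D \<le> ?j" by (rule mult_le_mono1)
      then have "(2 * w' + 1) * D + D \<le> ?j" by (simp add: algebra_simps)
      from swappable_swap_tails[OF av len uv(3) this]
      show "\<not> swappable D ((2 * w' + 1) * D) (swap_tails ?j (u, v))"
        using uv(4) w' by (auto simp: stuck_def)
    qed
    ultimately show "swap_tails ?j z \<in> first_swappable N D w (m + 1) (n - 1)"
      by (simp add: first_swappable_def mem_Times_iff zuv)
  qed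
qed simp

lemma card_pairs_eq:
  "card (awords N D n) * card (awords N D m) =
    (\<Sum>w<r. card (first_swappable N D w n m)) + card (stuck_pairs N D r n m)"
proof (induction r)
  case 0
  have "stuck_pairs N D 0 n m = awords N D n \<times> awords N D m"
    by (auto simp: stuck_pairs_def stuck_def)
  then show ?case by (simp add: card_cartesian_product)
next
  case (Suc r)
  have "stuck_pairs N D r n m = first_swappable N D r n m \<union> stuck_pairs N D (Suc r) n m"
    by (auto simp: stuck_pairs_def first_swappable_def stuck_def less_Suc_eq)
  moreover have "first_swappable N D r n m \<inter> stuck_pairs N D (Suc r) n m = {}"
    by (auto simp: stuck_pairs_def first_swappable_def stuck_def)
  ultimately have "card (stuck_pairs N D r n m) =
      card (first_swappable N D r n m) + card (stuck_pairs N D (Suc r) n m)"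
    by (metis card_Un_disjoint finite_first_swappable finite_stuck_pairs)
  then show ?case using Suc by simp
qed

text \<open>The map from lengths (n, m) to (m + 1, n - 1) interchanges (n + 2, n) and (n + 1, n +
  1), so \<open>card_first_swappable_le\<close> applies in both directions.\<close>

lemma sum_card_first_swappable:
  assumes "2 * r * D \<le> n"
  shows "(\<Sum>w<r. card (first_swappable N D w (n + 2) n)) =
    (\<Sum>w<r. card (first_swappable N D w (n + 1) (n + 1)))"
proof (rule sum.cong[OF refl])
  fix w assume "w \<in> {..<r}"
  then have "2 * w + 1 \<le> 2 * r" by simp
  then have "(2 * w + 1) * D \<le> 2 * r * D" by (rule mult_le_mono1)
  then have "(2 * w + 1) * D \<le> n" using assms by linarith
  then show "card (first_swappable N D w (n + 2) n) = card (first_swappable N D w (n + 1) (n + 1))"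
    using card_first_swappable_le[of w D "n + 2" n N] card_first_swappable_le[of w D "n + 1" "n + 1" N]
    by (intro antisym) auto
qed

section \<open>Pairs that no cut point can exchange are rare\<close>

context few_loops
begin

text \<open>One of the two crossed concatenations fails, with proportion at most
  \<open>\<tau>\<close> each; the two halves that do not enter it are free.\<close>

lemma card_stuck_blocks_le:
  assumes "D \<le> L"
  shows "real (card (stuck_blocks N D)) \<le> 2 * \<tau> * num_awords N D D ^ 4"
proof -
  let ?W = "awords N D (2 * D)" and ?T = "fails N D D D \<times> (awords N D D \<times> awords N D D)"
  define F1 where "F1 = {(b, b') \<in> ?W \<times> ?W. \<not> avoiding D (take D b @ drop D b')}"
  define F2 where "F2 = {(b, b') \<in> ?W \<times> ?W. \<not> avoiding D (take D b' @ drop D b)}"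
  have fin: "finite F1" "finite F2"
    by (rule finite_subset[of _ "?W \<times> ?W"], auto simp: F1_def F2_def)+
  have sp: "take D b \<in> awords N D D" "drop D b \<in> awords N D D" if "b \<in> ?W" for b
    using that awords_split[of b N D D D] by (auto simp: mult_2)
  have finT: "finite ?T" by simp
  have "card F1 \<le> card ?T"
    using finT by (intro card_inj_on_le[OF inj_on_split_cross]) (auto simp: F1_def fails_def sp)
  moreover have "card F2 \<le> card ?T"
    using finT by (intro card_inj_on_le[OF inj_on_split_cross']) (auto simp: F2_def fails_def sp)
  moreover have "card (stuck_blocks N D) \<le> card (F1 \<union> F2)"
    using fin by (intro card_mono) (auto simp: stuck_blocks_def F1_def F2_def)
  moreover have "card (F1 \<union> F2) \<le> card F1 + card F2" by (rule card_Un_le)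
  ultimately have "card (stuck_blocks N D) \<le> 2 * card ?T" by linarith
  then have "real (card (stuck_blocks N D)) \<le> real (2 * card ?T)" by (rule of_nat_mono)
  also have "\<dots> = 2 * (real (card (fails N D D D)) * (num_awords N D D * num_awords N D D))"
    by (simp add: num_awords_def)
  also have "\<dots> \<le> 2 * (\<tau> * (num_awords N D D * num_awords N D D) * (num_awords N D D * num_awords N D D))"
    using assms by (intro mult_left_mono mult_right_mono card_fails_le_tau) auto
  finally show ?thesis by (simp add: eval_nat_numeral mult_ac)
qed

text \<open>Each stuck pair of blocks contributes \<open>2 * \<tau>\<close>. Reassembling the pieces
  takes \<open>2 * r\<close> concatenations in either word, each costing 2, so 16 per cut point and
  32 in total; the leading 2 comes from putting back the first letter.\<close>

lemma card_stuck_pairs_le: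
  assumes "D \<le> L" "\<tau> \<le> 1 / 2" "2 * r * D + 1 \<le> n'" "2 * r * D \<le> m'"
  shows "real (card (stuck_pairs N D r n' m')) \<le>
    2 * (32 * \<tau>) ^ r * (num_awords N D n' * num_awords N D m')"
proof -
  let ?c = "num_awords N D"
  define k where "k = 2 * r * D"
  have "card (stuck_pairs N D r n' m') \<le> card (awords N D 1) * card (stuck_blocks N D) ^ r *
      (card (awords N D (n' - (k + 1))) * card (awords N D (m' - k)))"
    unfolding k_def
    by (rule order_trans[OF card_stuck_pairs_le_truncated[OF assms(3,4)] mult_le_mono1[OF card_stuck_pairs_base]])
  then have "real (card (stuck_pairs N D r n' m')) \<le>
      real (card (awords N D 1) * card (stuck_blocks N D) ^ r *
      (card (awords N D (n' - (k + 1))) * card (awords N D (m' - k))))"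
    by (rule of_nat_mono)
  also have "\<dots> = ?c 1 * real (card (stuck_blocks N D)) ^ r * (?c (n' - (k + 1)) * ?c (m' - k))"
    by (simp add: num_awords_def)
  also have "\<dots> \<le> ?c 1 * (2 * \<tau> * ?c D ^ 4) ^ r * (?c (n' - (k + 1)) * ?c (m' - k))"
    using assms(1) by (intro mult_right_mono mult_left_mono power_mono card_stuck_blocks_le) auto
  also have "\<dots> = (2 * \<tau>) ^ r * ((?c 1 * (?c D ^ (2 * r) * ?c (n' - (k + 1)))) * (?c D ^ (2 * r) * ?c (m' - k)))"
  proof -
    have "(?c D ^ 4) ^ r = ?c D ^ (2 * r) * ?c D ^ (2 * r)"
      by (simp flip: power_mult power_add)
    then show ?thesis by (simp only: power_mult_distrib mult_ac)
  qed
  also have "\<dots> \<le> (2 * \<tau>) ^ r * ((?c 1 * (2 ^ (2 * r) * ?c (n' - (k + 1) + 2 * r * D))) *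
      (2 ^ (2 * r) * ?c (m' - k + 2 * r * D)))"
    using assms(1,2) \<tau>_nonneg by (intro mult_left_mono mult_mono num_awords_power_mult_le) auto
  also have "m' - k + 2 * r * D = m'" using assms(4) by (simp add: k_def)
  also have "n' - (k + 1) + 2 * r * D = n' - 1" using assms(3) by (simp add: k_def)
  also have "(2 * \<tau>) ^ r * ((?c 1 * (2 ^ (2 * r) * ?c (n' - 1))) * (2 ^ (2 * r) * ?c m')) =
      (2 * \<tau>) ^ r * (2 ^ (2 * r) * 2 ^ (2 * r)) * ((?c 1 * ?c (n' - 1)) * ?c m')"
    by (simp only: mult_ac)
  also have "(2 * \<tau>) ^ r * (2 ^ (2 * r) * 2 ^ (2 * r)) = (32 * \<tau>) ^ r"
  proof -
    have "(2 ^ (2 * r) * 2 ^ (2 * r) :: real) = 16 ^ r"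
      unfolding power_add[symmetric] mult_2[symmetric] by (simp add: power_mult)
    moreover have "32 * \<tau> = 2 * \<tau> * 16" by simp
    ultimately show ?thesis by (simp only: power_mult_distrib)
  qed
  also have "(32 * \<tau>) ^ r * (?c 1 * ?c (n' - 1) * ?c m') \<le> (32 * \<tau>) ^ r * ((2 * ?c (1 + (n' - 1))) * ?c m')"
    using assms(1,2) \<tau>_nonneg by (intro mult_left_mono mult_right_mono num_awords_mult_le) auto
  also have "1 + (n' - 1) = n'" using assms(3) by simp
  finally show ?thesis by (simp add: mult_ac)
qed

text \<open>The exchangeable pairs of lengths (n + 2, n) and (n + 1, n + 1) are equinumerous, so the
  two products differ only by their numbers of stuck pairs.\<close>

lemma num_awords_second_difference:
  assumes D: "D \<le> L" "\<tau> \<le> 1 / 2" and r: "2 * r * D \<le> n"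
  shows "\<bar>num_awords N D (n + 2) * num_awords N D n - num_awords N D (n + 1) ^ 2\<bar> \<le>
    2 * (32 * \<tau>) ^ r * (real N * (num_awords N D n * num_awords N D (n + 1)))"
proof -
  let ?c = "num_awords N D" and ?S = "\<lambda>n m. real (card (stuck_pairs N D r n m))"
  have "?c (n + 2) * ?c n - ?S (n + 2) n = ?c (n + 1) * ?c (n + 1) - ?S (n + 1) (n + 1)"
  proof -
    have "real (card (awords N D (n + 2)) * card (awords N D n)) - ?S (n + 2) n =
       real (card (awords N D (n + 1)) * card (awords N D (n + 1))) - ?S (n + 1) (n + 1)"
      unfolding card_pairs_eq[where r = r] sum_card_first_swappable[OF r] by simp
    then show ?thesis by (simp add: num_awords_def)
  qed
  moreover have "?S (n + 2) n \<le> 2 * (32 * \<tau>) ^ r * (real N * (?c n * ?c (n + 1)))"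
  proof -
    have "?S (n + 2) n \<le> 2 * (32 * \<tau>) ^ r * (?c (n + 2) * ?c n)"
      using D r by (intro card_stuck_pairs_le) auto
    also have "\<dots> \<le> 2 * (32 * \<tau>) ^ r * ((real N * ?c (n + 1)) * ?c n)"
      using num_awords_Suc_le[of D "n + 1"] \<tau>_nonneg by (intro mult_left_mono mult_right_mono) auto
    finally show ?thesis by (simp add: mult_ac)
  qed
  moreover have "?S (n + 1) (n + 1) \<le> 2 * (32 * \<tau>) ^ r * (real N * (?c n * ?c (n + 1)))"
  proof -
    have "?S (n + 1) (n + 1) \<le> 2 * (32 * \<tau>) ^ r * (?c (n + 1) * ?c (n + 1))"
      using D r by (intro card_stuck_pairs_le) auto
    also have "\<dots> \<le> 2 * (32 * \<tau>) ^ r * ((real N * ?c n) * ?c (n + 1))"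
      using num_awords_Suc_le[of D n] \<tau>_nonneg by (intro mult_left_mono mult_right_mono) auto
    finally show ?thesis by (simp add: mult_ac)
  qed
  moreover have "0 \<le> ?S (n + 2) n" "0 \<le> ?S (n + 1) (n + 1)" by simp_all
  ultimately show ?thesis unfolding power2_eq_square by linarith
qed

end

section \<open>Asymptotics with bounded memory\<close>

lemma limit_of_telescoping_bound:
  fixes b u :: "nat \<Rightarrow> real"
  assumes step: "\<And>n. \<bar>b (Suc n) - b n\<bar> \<le> u n - u (Suc n)" and u: "u \<longlonglongrightarrow> 0"
  shows "\<exists>l. \<forall>n. \<bar>b n - l\<bar> \<le> u n"
proof -
  \<comment> \<open>The sequences \<open>b - u\<close> and \<open>b + u\<close> are monotone in
    opposite directions and squeeze the limit between them at every index.\<close>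
  have inc: "incseq (\<lambda>n. b n - u n)"
  proof (rule incseq_SucI)
    show "b n - u n \<le> b (Suc n) - u (Suc n)" for n using step[of n] by linarith
  qed
  have dec: "decseq (\<lambda>n. b n + u n)"
  proof (rule decseq_SucI)
    show "b (Suc n) + u (Suc n) \<le> b n + u n" for n using step[of n] by linarith
  qed
  have "decseq u"
  proof (rule decseq_SucI)
    show "u (Suc n) \<le> u n" for n using step[of n] abs_ge_zero[of "b (Suc n) - b n"] by linarith
  qed
  then have u0: "0 \<le> u n" for n using decseq_ge u by blast
  have "b n - u n \<le> b 0 + u 0" for n
    using decseqD[OF dec, of 0 n] u0[of n] by simp
  then obtain l where l: "(\<lambda>n. b n - u n) \<longlonglongrightarrow> l" "\<forall>n. b n - u n \<le> l"
    using incseq_convergent[OF inc] by metis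
  have "(\<lambda>n. (b n - u n) + (u n + u n)) \<longlonglongrightarrow> l + (0 + 0)"
    by (intro tendsto_add l u)
  then have "(\<lambda>n. b n + u n) \<longlonglongrightarrow> l" by (simp add: algebra_simps)
  then have "l \<le> b n + u n" for n using decseq_ge[OF dec] by blast
  then show ?thesis using l(2) by (intro exI[of _ l]) (auto simp: abs_le_iff algebra_simps)
qed

lemma abs_ln_diff_le:
  fixes a b :: real
  assumes "1 / 2 \<le> a" "1 / 2 \<le> b"
  shows "\<bar>ln a - ln b\<bar> \<le> 2 * \<bar>a - b\<bar>"
proof -
  have *: "ln a - ln b \<le> 2 * \<bar>a - b\<bar>" if "1 / 2 \<le> a" "1 / 2 \<le> b" for a b :: real
  proof -
    have "ln a - ln b = ln (a / b)" using that by (simp add: ln_div)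
    also have "\<dots> \<le> a / b - 1" using that by (intro ln_le_minus_one) auto
    also have "\<dots> = (a - b) / b" using that by (simp add: field_simps)
    also have "\<dots> \<le> \<bar>a - b\<bar> / (1 / 2)" using that by (intro frac_le) auto
    finally show ?thesis by simp
  qed
  show ?thesis using *[of a b] *[of b a] assms by (simp add: abs_le_iff abs_minus_commute)
qed

lemma abs_exp_minus_one_le:
  fixes y :: real
  assumes "\<bar>y\<bar> \<le> c"
  shows "\<bar>exp y - 1\<bar> \<le> exp c * \<bar>y\<bar>"
proof (cases "y \<ge> 0")
  case True
  have "exp y * (1 - y) \<le> exp y * exp (- y)"
    using exp_ge_add_one_self[of "- y"] by (intro mult_left_mono) auto
  then have "exp y - 1 \<le> exp y * y" by (simp add: exp_minus algebra_simps)
  also have "\<dots> \<le> exp c * y" using True assms by (intro mult_right_mono) auto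
  finally show ?thesis using True by simp
next
  case False
  then have "\<bar>exp y - 1\<bar> = 1 - exp y" by simp
  also have "\<dots> \<le> \<bar>y\<bar>" using False exp_ge_add_one_self[of y] by linarith
  also have "\<dots> \<le> exp c * \<bar>y\<bar>"
    using mult_right_mono[of 1 "exp c" "\<bar>y\<bar>"] assms by simp
  finally show ?thesis .
qed

lemma LIMSEQ_const_over_n: "(\<lambda>n. c / (real n + 1)) \<longlonglongrightarrow> (0::real)"
proof -
  have "(\<lambda>n. c * inverse (real (Suc n))) \<longlonglongrightarrow> c * 0"
    by (intro tendsto_mult_left LIMSEQ_inverse_real_of_nat)
  then show ?thesis by (simp add: divide_inverse add.commute)
qed

lemma LIMSEQ_const_over_n2: "(\<lambda>n. c / ((real n + 1) * (real n + 2))) \<longlonglongrightarrow> (0::real)"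
proof -
  have "(\<lambda>n. (c / (real n + 1)) * (1 / (real (Suc n) + 1))) \<longlonglongrightarrow> 0 * 0"
    by (intro tendsto_mult LIMSEQ_const_over_n LIMSEQ_Suc)
  then show ?thesis by (simp add: add_ac)
qed

text \<open>\<open>limit_of_telescoping_bound\<close> is applied twice: to the ratios, which gives
  the growth rate with error of order 1/n^2, and then to the logarithms of the normalised counts,
  which gives the amplitude with error of order 1/n. Each summation loses one power of the cubic
  bound in \<open>step\<close>.\<close>

lemma geometric_asymptotics_of_ratios:
  fixes c s :: "nat \<Rightarrow> real"
  assumes N: "N > 0" and C: "C \<ge> 0"
    and c0: "c 0 = 1" and cS: "\<And>n. c (Suc n) = N * s n * c n"
    and s: "\<And>n. 1 / 2 \<le> s n" "\<And>n. s n \<le> 1"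
    and step: "\<And>n. \<bar>s (Suc n) - s n\<bar> \<le> 2 * C / ((real n + 1) * (real n + 2) * (real n + 3))"
  shows "\<exists>A \<mu>. exp (- 2 * C) \<le> A \<and> A \<le> exp (2 * C) \<and> N / 2 \<le> \<mu> \<and> \<mu> \<le> N \<and>
    (\<forall>n. \<bar>c n / (A * \<mu> ^ n) - 1\<bar> \<le> 2 * C * exp (2 * C) / (real n + 1))"
proof -
  define u where "u n = C / ((real n + 1) * (real n + 2))" for n
  have tele: "u n - u (Suc n) = 2 * C / ((real n + 1) * (real n + 2) * (real n + 3))" for n
  proof -
    have "real n + 1 > 0" "real n + 2 > 0" "real n + 3 > 0" by simp_all
    then show ?thesis unfolding u_def
      by (simp add: divide_simps) (simp add: algebra_simps)
  qed
  have u0: "u \<longlonglongrightarrow> 0" unfolding u_def by (rule LIMSEQ_const_over_n2)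
  have "\<exists>l. \<forall>n. \<bar>s n - l\<bar> \<le> u n"
    by (rule limit_of_telescoping_bound[OF _ u0]) (unfold tele, rule step)
  then obtain l where l: "\<And>n. \<bar>s n - l\<bar> \<le> u n" by blast
  have "(\<lambda>n. s n - l) \<longlonglongrightarrow> 0"
  proof (rule tendsto_0_le[OF u0])
    show "\<forall>\<^sub>F n in sequentially. norm (s n - l) \<le> norm (u n) * 1"
      using l order_trans[OF l abs_ge_self] by simp
  qed
  then have lim: "s \<longlonglongrightarrow> l" by (rule LIM_zero_cancel)
  have l_bounds: "1 / 2 \<le> l" "l \<le> 1"
    using LIMSEQ_le_const[OF lim, of "1 / 2"] LIMSEQ_le_const2[OF lim, of 1] s by auto
  define \<mu> where "\<mu> = N * l"
  have \<mu>: "\<mu> > 0" using N l_bounds by (simp add: \<mu>_def)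
  have cpos: "c n > 0" for n
  proof (induction n)
    case (Suc n)
    have "s n > 0" using s(1)[of n] by linarith
    then show ?case using Suc N by (simp add: cS)
  qed (simp add: c0)
  define b where "b n = ln (c n / \<mu> ^ n)" for n
  define v where "v n = 2 * C / (real n + 1)" for n
  have bstep: "\<bar>b (Suc n) - b n\<bar> \<le> v n - v (Suc n)" for n
  proof -
    have sp: "s n > 0" using s(1)[of n] by linarith
    have "c (Suc n) / \<mu> ^ Suc n = (s n / l) * (c n / \<mu> ^ n)"
      using N l_bounds by (simp add: cS \<mu>_def)
    moreover have "0 < s n / l" "0 < c n / \<mu> ^ n" using sp l_bounds cpos[of n] \<mu> by auto
    ultimately have "b (Suc n) = ln (s n / l) + b n"
      unfolding b_def by (simp only: ln_mult_pos)
    then have "\<bar>b (Suc n) - b n\<bar> = \<bar>ln (s n) - ln l\<bar>" using sp l_bounds by (simp add: ln_div)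
    also have "\<dots> \<le> 2 * \<bar>s n - l\<bar>" by (rule abs_ln_diff_le) (use s l_bounds in auto)
    also have "\<dots> \<le> 2 * u n" using l by simp
    also have "\<dots> = v n - v (Suc n)"
    proof -
      have "real n + 1 > 0" "real n + 2 > 0" by simp_all
      then show ?thesis unfolding u_def v_def
        by (simp add: divide_simps) (simp add: algebra_simps)
    qed
    finally show ?thesis .
  qed
  have "v \<longlonglongrightarrow> 0" unfolding v_def by (rule LIMSEQ_const_over_n)
  then obtain a where a: "\<And>n. \<bar>b n - a\<bar> \<le> v n"
    using limit_of_telescoping_bound[of b v, OF bstep] by blast
  \<comment> \<open>The sequence \<open>b\<close> starts at \<open>ln 1 = 0\<close>, so its limit is
    at distance at most \<open>v 0\<close> from 0; this makes the bounds on the amplitude depend on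
    \<open>C\<close> alone.\<close>
  have "\<bar>a\<bar> \<le> 2 * C" using a[of 0] by (simp add: b_def c0 v_def)
  have "\<bar>c n / (exp a * \<mu> ^ n) - 1\<bar> \<le> 2 * C * exp (2 * C) / (real n + 1)" for n
  proof -
    have "c n / (exp a * \<mu> ^ n) = exp (b n - a)"
      using cpos[of n] \<mu> by (simp add: b_def exp_diff)
    moreover have "\<bar>b n - a\<bar> \<le> 2 * C"
      using a[of n] C by (simp add: v_def) (rule order_trans, assumption, simp add: divide_le_eq mult_le_cancel_left1)
    ultimately have "\<bar>c n / (exp a * \<mu> ^ n) - 1\<bar> \<le> exp (2 * C) * \<bar>b n - a\<bar>"
      using abs_exp_minus_one_le by simp
    also have "\<dots> \<le> exp (2 * C) * v n" by (intro mult_left_mono a) auto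
    finally show ?thesis by (simp add: v_def mult_ac)
  qed
  moreover have "N / 2 \<le> \<mu>" "\<mu> \<le> N" using N l_bounds by (auto simp: \<mu>_def)
  moreover have "exp (- 2 * C) \<le> exp a" "exp a \<le> exp (2 * C)" using \<open>\<bar>a\<bar> \<le> 2 * C\<close> by auto
  ultimately show ?thesis by blast
qed

text \<open>The exponent 8 comes from four factors of size \<open>n\<close>, each at most a constant
  times \<open>(s + 1)\<^sup>2\<close> when \<open>s\<close> is the integer part of
  \<open>sqrt n\<close>.\<close>

lemma polynomial_times_geometric_bounded:
  fixes x :: real
  assumes x: "0 < x" "x < 1"
  shows "\<exists>M>0. \<forall>s::nat. real (s + 1) ^ 8 * x ^ s \<le> M"
proof -
  define a where "a = - ln x"
  have a: "a > 0" using x by (simp add: a_def)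
  have "real (s + 1) ^ 8 * x ^ s \<le> fact 8 / (a ^ 8 * x)" for s :: nat
  proof -
    have "(a * real (s + 1)) ^ 8 \<le> fact 8 * exp (a * real (s + 1))"
      using a by (intro power_le_fact_exp) auto
    also have "exp (a * real (s + 1)) = inverse x ^ (s + 1)"
    proof -
      have "exp a = inverse x" using x by (simp add: a_def exp_minus)
      then show ?thesis by (simp only: exp_of_nat2_mult)
    qed
    finally have "(a * real (s + 1)) ^ 8 * x ^ (s + 1) \<le> fact 8 * inverse x ^ (s + 1) * x ^ (s + 1)"
      using x by (intro mult_right_mono) auto
    also have "\<dots> = fact 8"
    proof -
      have "inverse x ^ (s + 1) * x ^ (s + 1) = 1"
        using x by (simp only: power_mult_distrib[symmetric]) simp
      then show ?thesis by (simp only: mult.assoc mult_1_right)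
    qed
    finally have "a ^ 8 * real (s + 1) ^ 8 * x ^ (s + 1) \<le> fact 8"
      by (simp only: power_mult_distrib)
    then show ?thesis using x a by (simp add: field_simps)
  qed
  moreover have "fact 8 / (a ^ 8 * x) > 0" using a x by simp
  ultimately show ?thesis by blast
qed

section \<open>Regularity of the ratios of consecutive counts\<close>

context few_loops
begin

definition ratio :: "nat \<Rightarrow> real"
  where "ratio n = num_awords N L (Suc n) / (real N * num_awords N L n)"

lemma ratio_ge: "1 / 2 \<le> ratio n"
proof -
  have pos: "0 < num_awords N L n" by (rule num_awords_pos) simp
  have "real N / 2 * num_awords N L n \<le> (real N - h) * num_awords N L n"
    using N_pos by (intro mult_right_mono) auto
  also have "\<dots> \<le> num_awords N L (Suc n)" by (rule num_awords_Suc_ge) simp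
  finally show ?thesis using pos N_pos by (simp add: ratio_def field_simps)
qed

lemma ratio_le: "ratio n \<le> 1"
  using num_awords_Suc_le[of L n] num_awords_pos[of L n] N_pos by (simp add: ratio_def field_simps)

lemmas ratio_bounds = ratio_ge ratio_le

text \<open>The exchange argument runs with a memory \<open>D\<close> that may be shorter than
  \<open>L\<close>, since its cut points need room proportional to \<open>D\<close>;
  \<open>e\<close> is the relative error of replacing one memory by the other. For \<open>e\<close>
  above 1/2 the claim is trivial, as all ratios lie between 1/2 and 1.\<close>

lemma ratio_diff_le_aux:
  assumes D: "D \<le> L" "\<tau> \<le> 1 / 2" and r: "2 * r * D \<le> n" and e: "0 \<le> e"
    and cmp: "\<And>k. k \<le> n + 2 \<Longrightarrow> num_awords N D k - num_awords N L k \<le> e * num_awords N D k"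
  shows "\<bar>ratio (Suc n) - ratio n\<bar> \<le> 16 * e + 8 * (32 * \<tau>) ^ r"
proof (cases "e \<le> 1 / 2")
  case False
  have "\<bar>ratio (Suc n) - ratio n\<bar> \<le> 1"
    using ratio_bounds[of n] ratio_bounds[of "Suc n"] by (auto simp: abs_le_iff)
  moreover have "0 \<le> (32 * \<tau>) ^ r" using \<tau>_nonneg by simp
  ultimately show ?thesis using False by linarith
next
  case True
  let ?c = "num_awords N L" and ?d = "num_awords N D"
  define \<eta> where "\<eta> = 2 * (32 * \<tau>) ^ r"
  have \<eta>: "0 \<le> \<eta>" using \<tau>_nonneg by (simp add: \<eta>_def)
  have pos: "0 < ?c n" "0 < ?c (n + 1)" using num_awords_pos by auto
  have le: "?c k \<le> ?d k" for k using D(1) by (rule num_awords_antimono)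
  have half: "?d k \<le> 2 * ?c k" if "k \<le> n + 2" for k
  proof -
    have "e * ?d k \<le> 1 / 2 * ?d k" using True by (intro mult_right_mono) auto
    then show ?thesis using cmp[OF that] by linarith
  qed
  have prod: "?d k * ?d m - ?c k * ?c m \<le> 2 * e * (?d k * ?d m)" "0 \<le> ?d k * ?d m - ?c k * ?c m"
    if "k \<le> n + 2" "m \<le> n + 2" for k m
  proof -
    have "?d k * ?d m - ?c k * ?c m = (?d k - ?c k) * ?d m + ?c k * (?d m - ?c m)"
      by (simp add: algebra_simps)
    also have "\<dots> \<le> e * ?d k * ?d m + ?d k * (e * ?d m)"
      using that le cmp e by (intro add_mono mult_mono) (auto simp: le)
    finally show "?d k * ?d m - ?c k * ?c m \<le> 2 * e * (?d k * ?d m)" by (simp add: algebra_simps)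
    show "0 \<le> ?d k * ?d m - ?c k * ?c m" using mult_mono[OF le le] by simp
  qed
  let ?R = "real N * (?d n * ?d (n + 1))"
  have R1: "?d (n + 2) * ?d n \<le> ?R"
    using num_awords_Suc_le[of D "n + 1"] mult_right_mono[of "?d (n + 2)" "real N * ?d (n + 1)" "?d n"]
    by (simp add: mult_ac)
  have R2: "?d (n + 1) * ?d (n + 1) \<le> ?R"
    using num_awords_Suc_le[of D n] mult_right_mono[of "?d (n + 1)" "real N * ?d n" "?d (n + 1)"]
    by (simp add: mult_ac)
  have "2 * e * (?d (n + 2) * ?d n) \<le> 2 * e * ?R" "2 * e * (?d (n + 1) * ?d (n + 1)) \<le> 2 * e * ?R"
    using R1 R2 e by (auto intro!: mult_left_mono)
  moreover have "\<bar>?d (n + 2) * ?d n - ?d (n + 1) ^ 2\<bar> \<le> \<eta> * ?R"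
    unfolding \<eta>_def by (rule num_awords_second_difference[OF D r])
  ultimately have "\<bar>?c (n + 2) * ?c n - ?c (n + 1) * ?c (n + 1)\<bar> \<le> 2 * e * ?R + 2 * e * ?R + \<eta> * ?R"
    using prod[of "n + 2" n] prod[of "n + 1" "n + 1"] unfolding power2_eq_square by simp
  also have "\<dots> = (4 * e + \<eta>) * ?R" by (simp add: algebra_simps)
  \<comment> \<open>Returning to memory \<open>L\<close> costs a factor 2 for each of the two
    counts, which turns \<open>4 * e\<close> into \<open>16 * e\<close>.\<close>
  also have "\<dots> \<le> (4 * e + \<eta>) * (real N * ((2 * ?c n) * (2 * ?c (n + 1))))"
    using e \<eta> half[of n] half[of "n + 1"] by (intro mult_left_mono mult_mono) auto
  finally have main: "\<bar>?c (n + 2) * ?c n - ?c (n + 1) * ?c (n + 1)\<bar> \<le>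
      (16 * e + 4 * \<eta>) * (real N * (?c n * ?c (n + 1)))"
    by (simp add: algebra_simps)
  have "ratio (Suc n) - ratio n =
      (?c (n + 2) * ?c n - ?c (n + 1) * ?c (n + 1)) / (real N * (?c n * ?c (n + 1)))"
    using pos N_pos by (simp add: ratio_def field_simps)
  then have "\<bar>ratio (Suc n) - ratio n\<bar> =
      \<bar>?c (n + 2) * ?c n - ?c (n + 1) * ?c (n + 1)\<bar> / (real N * (?c n * ?c (n + 1)))"
    using pos N_pos by (simp add: abs_mult)
  also have "\<dots> \<le> 16 * e + 4 * \<eta>"
    using main pos N_pos by (simp add: pos_divide_le_eq)
  finally show ?thesis by (simp add: \<eta>_def)
qed

text \<open>
  Here \<open>s\<close> will be about \<open>sqrt n\<close>: comparison with memory \<open>s\<close> costs \<open>x ^ s\<close>, and with that memory there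
  is room for about \<open>s / 2\<close> cut points.
\<close>

lemma ratio_diff_le_sqrt:
  assumes \<tau>: "\<tau> \<le> 1 / 2" "32 * \<tau> \<le> x ^ 4" and s: "s * s \<le> n"
  shows "\<bar>ratio (Suc n) - ratio n\<bar> \<le> (32 * B / (1 - x) + 8 / x) * (real n + 3) * x ^ s"
proof -
  define r where "r = s div 2"
  have rs: "2 * r \<le> s" "s \<le> 2 * r + 1" unfolding r_def by linarith+
  have pw: "(32 * \<tau>) ^ r \<le> x ^ s / x"
  proof -
    have "(32 * \<tau>) ^ r \<le> (x ^ 4) ^ r" using \<tau> \<tau>_nonneg by (intro power_mono) auto
    also have "\<dots> = x ^ (4 * r)" by (simp add: power_mult)
    also have "\<dots> \<le> x ^ (s - 1)" using x rs by (intro power_decreasing) auto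
    also have "\<dots> \<le> x ^ s / x" using x by (cases s) (auto simp: field_simps)
    finally show ?thesis .
  qed
  have N1: "1 \<le> real N" using N_pos by simp
  have nn: "0 \<le> 32 * B / (1 - x) * (real n + 3) * x ^ s" using x B by simp
  have "\<bar>ratio (Suc n) - ratio n\<bar> \<le> 32 * B / (1 - x) * (real n + 3) * x ^ s + 8 * (32 * \<tau>) ^ r"
  proof (cases "s \<le> L")
    case True
    define e where "e = 2 * (real n + 3) * (B / real N * (x ^ Suc s / (1 - x)))"
    have "2 * r * s \<le> n" using mult_le_mono1[OF rs(1), of s] s by linarith
    moreover have "num_awords N s k - num_awords N L k \<le> e * num_awords N s k" if "k \<le> n + 2" for k
    proof -
      have "num_awords N s k - num_awords N L k \<le> 2 * real (Suc k) * (B / real N * (x ^ Suc s / (1 - x))) * num_awords N s k"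
        using True \<tau> by (intro num_awords_memory_diff_le) auto
      also have "\<dots> \<le> e * num_awords N s k"
        unfolding e_def using that x B by (intro mult_right_mono) auto
      finally show ?thesis .
    qed
    ultimately have "\<bar>ratio (Suc n) - ratio n\<bar> \<le> 16 * e + 8 * (32 * \<tau>) ^ r"
      using True \<tau> x B by (intro ratio_diff_le_aux[where D = s]) (auto simp: e_def)
    moreover have "e \<le> 2 * (real n + 3) * (B / 1 * (x ^ s / (1 - x)))"
      unfolding e_def using x B N1
      by (intro mult_left_mono mult_mono divide_left_mono divide_right_mono power_decreasing) auto
    moreover have "16 * (2 * (real n + 3) * (B / 1 * (x ^ s / (1 - x)))) =
        32 * B / (1 - x) * (real n + 3) * x ^ s"
      by simp
    ultimately show ?thesis by linarith
  next
    \<comment> \<open>When the target memory \<open>L\<close> is already shorter than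
      \<open>s\<close>, the exchange is carried out with memory \<open>L\<close> itself and there is
      no comparison error.\<close>
    case False
    have "2 * r * L \<le> s * s" using rs False by (intro mult_le_mono) auto
    then have "\<bar>ratio (Suc n) - ratio n\<bar> \<le> 16 * 0 + 8 * (32 * \<tau>) ^ r"
      using s \<tau> by (intro ratio_diff_le_aux[where D = L]) auto
    then show ?thesis using nn by linarith
  qed
  also have "\<dots> \<le> 32 * B / (1 - x) * (real n + 3) * x ^ s + 8 * ((real n + 3) * (x ^ s / x))"
    using pw x mult_right_mono[of 1 "real n + 3" "x ^ s / x"] by (intro add_left_mono mult_left_mono) auto
  finally show ?thesis by (simp add: algebra_simps add_divide_distrib)
qed

end

text \<open>With \<open>s\<close> the integer part of \<open>sqrt n\<close>, the bound
  \<open>x ^ s\<close> beats every power of \<open>n\<close>, in particular the cubic rate required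
  by \<open>geometric_asymptotics_of_ratios\<close>. The constant depends on \<open>B\<close> and
  \<open>x\<close> only, which is the uniformity in \<open>N\<close> and \<open>L\<close>.\<close>

lemma few_loops_asymptotics:
  fixes B x :: real
  assumes x: "0 < x" "x < 1" and B: "0 < B"
  shows "\<exists>C>0. \<forall>N L h. few_loops N L B x h \<and> few_loops.\<tau> N B x \<le> 1 / 2 \<and> 32 * few_loops.\<tau> N B x \<le> x ^ 4 \<longrightarrow>
    (\<exists>A \<mu>. exp (- C) \<le> A \<and> A \<le> exp C \<and> real N / 2 \<le> \<mu> \<and> \<mu> \<le> real N \<and>
      (\<forall>n. \<bar>num_awords N L n / (A * \<mu> ^ n) - 1\<bar> \<le> C * exp C / (real n + 1)))"
proof -
  obtain M where M: "M > 0" "\<And>s::nat. real (s + 1) ^ 8 * x ^ s \<le> M"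
    using polynomial_times_geometric_bounded[OF x] by blast
  define C0 where "C0 = 32 * B / (1 - x) + 8 / x"
  have C0: "C0 > 0" using x B by (simp add: C0_def add_pos_pos)
  define C where "C = 81 * C0 * M"
  have C: "C > 0" using C0 M by (simp add: C_def)
  have "\<exists>A \<mu>. exp (- C) \<le> A \<and> A \<le> exp C \<and> real N / 2 \<le> \<mu> \<and> \<mu> \<le> real N \<and>
      (\<forall>n. \<bar>num_awords N L n / (A * \<mu> ^ n) - 1\<bar> \<le> C * exp C / (real n + 1))"
    if fl: "few_loops N L B x h" and \<tau>: "few_loops.\<tau> N B x \<le> 1 / 2" "32 * few_loops.\<tau> N B x \<le> x ^ 4" for N L h
  proof -
    interpret few_loops N L B x h by (rule fl)
    have "\<exists>A \<mu>. exp (- 2 * (C / 2)) \<le> A \<and> A \<le> exp (2 * (C / 2)) \<and> real N / 2 \<le> \<mu> \<and> \<mu> \<le> real N \<and>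
      (\<forall>n. \<bar>num_awords N L n / (A * \<mu> ^ n) - 1\<bar> \<le> 2 * (C / 2) * exp (2 * (C / 2)) / (real n + 1))"
    proof (rule geometric_asymptotics_of_ratios[where s = ratio])
      show "num_awords N L (Suc n) = real N * ratio n * num_awords N L n" for n
        using num_awords_pos[of L n] N_pos by (simp add: ratio_def)
      show "\<bar>ratio (Suc n) - ratio n\<bar> \<le> 2 * (C / 2) / ((real n + 1) * (real n + 2) * (real n + 3))" for n
      proof -
        obtain s where s: "s * s \<le> n" "n < (s + 1) * (s + 1)"
        proof -
          define s where "s = nat \<lfloor>sqrt (real n)\<rfloor>"
          have "real s \<le> sqrt (real n)" "sqrt (real n) < real s + 1"
            by (simp_all add: s_def)
          then have "real s ^ 2 \<le> sqrt (real n) ^ 2" "sqrt (real n) ^ 2 < (real s + 1) ^ 2"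
            by (intro power_mono power_strict_mono; simp)+
          then have "real (s * s) \<le> real n" "real n < real ((s + 1) * (s + 1))"
            by (simp_all add: power2_eq_square algebra_simps)
          then show ?thesis using that[of s] by (simp only: of_nat_le_iff of_nat_less_iff)
        qed
        let ?q = "real (s + 1) ^ 2"
        have "real (n + 1) \<le> real ((s + 1) * (s + 1))" using s(2) by (simp only: of_nat_le_iff)
        then have "real n + 1 \<le> ?q" by (simp only: of_nat_mult power2_eq_square of_nat_add of_nat_1)
        moreover have "1 \<le> ?q" by simp
        ultimately have q: "real n + 3 \<le> 3 * ?q" "real n + 2 \<le> 3 * ?q" "real n + 1 \<le> 3 * ?q"
          by simp_all
        have "\<bar>ratio (Suc n) - ratio n\<bar> \<le> C0 * (real n + 3) * x ^ s"
          unfolding C0_def by (rule ratio_diff_le_sqrt[OF \<tau> s(1)])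
        then have "\<bar>ratio (Suc n) - ratio n\<bar> * ((real n + 1) * (real n + 2) * (real n + 3)) \<le>
            C0 * (real n + 3) * x ^ s * ((real n + 1) * (real n + 2) * (real n + 3))"
          by (intro mult_right_mono) auto
        also have "\<dots> = C0 * x ^ s * ((real n + 3) * ((real n + 1) * (real n + 2) * (real n + 3)))"
          by (simp only: mult_ac)
        also have "\<dots> \<le> C0 * x ^ s * ((3 * ?q) * ((3 * ?q) * (3 * ?q) * (3 * ?q)))"
          using q C0 x by (intro mult_left_mono mult_mono) auto
        also have "\<dots> = 81 * C0 * (real (s + 1) ^ 8 * x ^ s)"
          by (simp add: algebra_simps flip: power_add)
        also have "\<dots> \<le> C" unfolding C_def using C0 M by (intro mult_left_mono) auto
        finally show ?thesis by (simp add: pos_le_divide_eq)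
      qed
    qed (use N_pos C ratio_bounds num_awords_0 in auto)
    then show ?thesis by simp
  qed
  then show ?thesis using C by blast
qed

section \<open>Walks as words\<close>

definition vertex :: "nat \<Rightarrow> nat set \<Rightarrow> bit list"
  where "vertex N S = map (\<lambda>i. if i \<in> S then 1 else 0) [0..<N]"

lemma length_vertex [simp]: "length (vertex N S) = N"
  by (simp add: vertex_def)

lemma vertex_empty: "vertex N {} = cube_zero N"
  by (simp add: vertex_def cube_zero_def map_replicate_const)

lemma vertex_nth: "i < N \<Longrightarrow> vertex N S ! i = 1 \<longleftrightarrow> i \<in> S"
  by (simp add: vertex_def)

lemma vertex_eq_iff:
  assumes "S \<subseteq> {..<N}" "T \<subseteq> {..<N}"
  shows "vertex N S = vertex N T \<longleftrightarrow> S = T"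
proof
  assume eq: "vertex N S = vertex N T"
  have "i \<in> S \<longleftrightarrow> i \<in> T" for i
    using assms vertex_nth[of i N S] vertex_nth[of i N T] eq by (cases "i < N") auto
  then show "S = T" by blast
qed simp

lemma vertex_support:
  assumes "length x = N"
  shows "vertex N {i. i < N \<and> x ! i = 1} = x"
proof (rule nth_equalityI)
  fix i assume "i < length (vertex N {i. i < N \<and> x ! i = 1})"
  then show "vertex N {i. i < N \<and> x ! i = 1} ! i = x ! i"
    by (cases "x ! i = 1") (auto simp: vertex_def)
qed (use assms in simp)

lemma weight_diff_vertex:
  assumes "S \<subseteq> {..<N}" "T \<subseteq> {..<N}"
  shows "weight (cube_diff (vertex N S) (vertex N T)) = card (sym_diff S T)"
proof -
  have "{i. i < length (cube_diff (vertex N S) (vertex N T)) \<and>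
      cube_diff (vertex N S) (vertex N T) ! i = 1} = sym_diff S T"
    using assms by (auto simp: cube_diff_def vertex_def split: if_splits)
  then show ?thesis by (simp add: weight_def)
qed

definition word_walk :: "nat \<Rightarrow> nat \<Rightarrow> nat list \<Rightarrow> nat \<Rightarrow> bit list"
  where "word_walk N n w = (\<lambda>i\<in>{0..n}. vertex N (odd_letters (take i w)))"

lemma odd_letters_take_Suc: "i < length w \<Longrightarrow> odd_letters (take (Suc i) w) = sym_diff (odd_letters (take i w)) {w ! i}"
  by (auto simp: take_Suc_conv_app_nth odd_letters_append odd_letters_Cons)

lemma odd_letters_take_subset: "set w \<subseteq> {..<N} \<Longrightarrow> odd_letters (take i w) \<subseteq> {..<N}"
  using odd_letters_subset[of "take i w"] set_take_subset[of i w] by blast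

text \<open>A contiguous subword is closed iff the walk is at the same vertex before and after it,
  and no subword is longer than the word itself.\<close>

lemma avoiding_length:
  assumes "length w \<le> D"
  shows "avoiding D w \<longleftrightarrow> (\<forall>i j. i < j \<longrightarrow> j \<le> length w \<longrightarrow> odd_letters (take i w) \<noteq> odd_letters (take j w))"
proof
  assume *: "avoiding D w"
  show "\<forall>i j. i < j \<longrightarrow> j \<le> length w \<longrightarrow> odd_letters (take i w) \<noteq> odd_letters (take j w)"
  proof (intro allI impI notI)
    fix i j assume ij: "i < j" "j \<le> length w" "odd_letters (take i w) = odd_letters (take j w)"
    let ?q = "drop i (take j w)"
    have "take j w = take i w @ ?q"
      using ij by (metis append_take_drop_id min.absorb1 less_imp_le take_take)
    then have "odd_letters (take i w) = sym_diff (odd_letters (take i w)) (odd_letters ?q)"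
      using ij(3) odd_letters_append by metis
    then have "odd_letters ?q = {}" by blast
    moreover have "sublist ?q w"
      using sublist_drop sublist_take sublist_order.order.trans by blast
    moreover have "?q \<noteq> []" "length ?q \<le> D" using ij assms by auto
    ultimately show False using * by (auto simp: avoiding_def)
  qed
next
  assume *: "\<forall>i j. i < j \<longrightarrow> j \<le> length w \<longrightarrow> odd_letters (take i w) \<noteq> odd_letters (take j w)"
  show "avoiding D w"
    unfolding avoiding_def
  proof (intro allI impI)
    fix q assume q: "sublist q w" "q \<noteq> []" "odd_letters q = {}"
    then obtain p s where w: "w = p @ q @ s" by (auto simp: sublist_def)
    have "odd_letters (take (length p) w) = odd_letters (take (length p + length q) w)"
      using q(3) by (simp add: w odd_letters_append)
    moreover have "length p < length p + length q" "length p + length q \<le> length w"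
      using q(2) by (auto simp: w)
    ultimately show "D < length q" using * by blast
  qed
qed

lemma word_walk_in_walks:
  assumes w: "w \<in> awords N n n"
  shows "word_walk N n w \<in> self_avoiding_walks N n"
proof -
  have w': "set w \<subseteq> {..<N}" "length w = n" "avoiding n w" using w by (auto simp: awords_def)
  have step: "weight (cube_diff (word_walk N n w i) (word_walk N n w (i - 1))) = 1" if "i \<in> {1..n}" for i
  proof -
    have "i - 1 < length w" using that w' by auto
    then have "sym_diff (odd_letters (take i w)) (odd_letters (take (i - 1) w)) = {w ! (i - 1)}"
      using odd_letters_take_Suc[of "i - 1" w] that by auto
    moreover have "i \<le> n" "i - 1 \<le> n" using that by auto
    ultimately show ?thesis
      using that weight_diff_vertex[OF odd_letters_take_subset[OF w'(1)] odd_letters_take_subset[OF w'(1)]]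
      by (simp add: word_walk_def)
  qed
  have "word_walk N n w i \<noteq> word_walk N n w j" if "i \<le> n" "j \<le> n" "i < j" for i j
    using that w' avoiding_length[of w n]
    by (simp add: word_walk_def vertex_eq_iff odd_letters_take_subset)
  then have "word_walk N n w i \<noteq> word_walk N n w j" if "i \<le> n" "j \<le> n" "i \<noteq> j" for i j
    using that by (metis linorder_neqE_nat)
  then show "word_walk N n w \<in> self_avoiding_walks N n"
    using step by (auto simp: self_avoiding_walks_def) (auto simp: word_walk_def cube_def)
qed

lemma word_walk_0: "word_walk N n w 0 = cube_zero N"
  by (simp add: word_walk_def vertex_empty)

lemma inj_on_word_walk: "inj_on (word_walk N n) (awords N n n)"
proof (rule inj_onI)
  fix v w assume vw: "v \<in> awords N n n" "w \<in> awords N n n" "word_walk N n v = word_walk N n w"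
  have odd_letters: "odd_letters (take i v) = odd_letters (take i w)" if "i \<le> n" for i
  proof -
    have "word_walk N n v i = word_walk N n w i" using vw(3) by simp
    then show ?thesis using that vw(1,2)
      by (simp add: word_walk_def awords_def vertex_eq_iff odd_letters_take_subset)
  qed
  show "v = w"
  proof (rule nth_equalityI)
    fix i assume i: "i < length v"
    then have "i < length w" using vw by (simp add: awords_def)
    moreover have "odd_letters (take i v) = odd_letters (take i w)" "odd_letters (take (Suc i) v) = odd_letters (take (Suc i) w)"
      using i vw by (auto intro!: odd_letters simp: awords_def)
    ultimately have "{v ! i} = {w ! i}" using odd_letters_take_Suc[OF i] odd_letters_take_Suc[of i w] by blast
    then show "v ! i = w ! i" by simp
  qed (use vw in \<open>simp add: awords_def\<close>)
qed

lemma word_walk_surj: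
  assumes \<omega>: "\<omega> \<in> self_avoiding_walks N n" "\<omega> 0 = cube_zero N"
  shows "\<omega> \<in> word_walk N n ` awords N n n"
proof -
  define S where "S i = {k. k < N \<and> \<omega> i ! k = 1}" for i
  have \<omega>': "\<omega> \<in> {0..n} \<rightarrow>\<^sub>E cube N"
    "\<And>i. i \<in> {1..n} \<Longrightarrow> weight (cube_diff (\<omega> i) (\<omega> (i - 1))) = 1"
    "\<And>i j. i \<le> n \<Longrightarrow> j \<le> n \<Longrightarrow> i \<noteq> j \<Longrightarrow> \<omega> i \<noteq> \<omega> j"
    using \<omega>(1) by (auto simp: self_avoiding_walks_def)
  have S: "\<omega> i = vertex N (S i)" if "i \<le> n" for i
  proof -
    have "length (\<omega> i) = N" using \<omega>'(1) that by (auto simp: cube_def PiE_def Pi_def)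
    then show ?thesis by (simp add: S_def vertex_support)
  qed
  have S_sub: "S i \<subseteq> {..<N}" for i by (auto simp: S_def)
  have S0: "S 0 = {}"
    using S[of 0] \<omega>(2) vertex_eq_iff[of "S 0" N "{}"] S_sub vertex_empty by simp
  have step: "\<exists>k. sym_diff (S (Suc i)) (S i) = {k}" if "i < n" for i
    using \<omega>'(2)[of "Suc i"] that S[of i] S[of "Suc i"] weight_diff_vertex[OF S_sub S_sub, of "Suc i" i]
    by (simp add: card_1_singleton_iff)
  \<comment> \<open>The letter at position \<open>i\<close> is the unique coordinate flipped by step
    \<open>i + 1\<close> of the walk.\<close>
  define w where "w = map (\<lambda>i. THE k. sym_diff (S (Suc i)) (S i) = {k}) [0..<n]"
  have len: "length w = n" by (simp add: w_def)
  have nth: "sym_diff (S (Suc i)) (S i) = {w ! i}" if lt: "i < n" for i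
  proof -
    obtain k where k: "sym_diff (S (Suc i)) (S i) = {k}" using step[OF lt] by blast
    then have "(THE k. sym_diff (S (Suc i)) (S i) = {k}) = k" by (intro the_equality) auto
    then show ?thesis using k lt by (simp add: w_def)
  qed
  have odd_letters: "odd_letters (take i w) = S i" if "i \<le> n" for i
    using that
  proof (induction i)
    case (Suc i)
    then have "odd_letters (take (Suc i) w) = sym_diff (S i) {w ! i}"
      using odd_letters_take_Suc[of i w] len by simp
    also have "\<dots> = S (Suc i)" using nth[of i] Suc.prems by auto
    finally show ?case .
  qed (simp add: S0)
  have "w ! i < N" if "i < n" for i
    using nth[OF that] S_sub[of i] S_sub[of "Suc i"] by blast
  then have "set w \<subseteq> {..<N}" using len by (auto simp: in_set_conv_nth)
  moreover have "avoiding n w"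
    using \<omega>'(3) S len odd_letters by (subst avoiding_length) (auto, metis le_trans less_imp_le nat_neq_iff)
  ultimately have "w \<in> awords N n n" using len by (simp add: awords_def)
  moreover have "\<omega> = word_walk N n w"
  proof (rule ext)
    fix i show "\<omega> i = word_walk N n w i"
      using \<omega>'(1) S[of i] odd_letters[of i]
      by (cases "i \<le> n") (auto simp: word_walk_def PiE_def extensional_def)
  qed
  ultimately show ?thesis by blast
qed

lemma saw_count_eq_num_awords: "real (saw_count N n) = num_awords N n n"
proof -
  have "{\<omega> \<in> self_avoiding_walks N n. \<omega> 0 = cube_zero N} = word_walk N n ` awords N n n"
    using word_walk_in_walks word_walk_0 word_walk_surj by blast
  then show ?thesis by (simp add: saw_count_def num_awords_def card_image[OF inj_on_word_walk])
qed

lemma num_awords_full: "n \<le> D \<Longrightarrow> num_awords N D n = num_awords N n n"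
  unfolding num_awords_def by (rule arg_cong[where f = "\<lambda>X. real (card X)"])
    (auto simp: awords_def avoiding_length)

lemma awords_full_subset: "awords N n n \<subseteq> awords N D n"
proof
  fix w assume w: "w \<in> awords N n n"
  have "D < length q" if q: "sublist q w" "q \<noteq> []" "odd_letters q = {}" for q
    using w q sublist_length_le[OF q(1)] by (auto simp: awords_def avoiding_def)
  then show "w \<in> awords N D n" using w by (auto simp: awords_def avoiding_def)
qed

lemma saw_count_add_le: "saw_count N (a + b) \<le> saw_count N a * saw_count N b"
proof -
  have "num_awords N (a + b) (a + b) \<le> num_awords N (a + b) a * num_awords N (a + b) b" by (rule num_awords_add_le)
  then have "real (saw_count N (a + b)) \<le> real (saw_count N a * saw_count N b)"
    using num_awords_full[of a "a + b" N] num_awords_full[of b "a + b" N] by (simp add: saw_count_eq_num_awords)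
  then show ?thesis by (simp only: of_nat_le_iff)
qed

section \<open>From bounded memory to full self-avoidance\<close>

context few_loops
begin

text \<open>
  The parities of the last \<open>L\<close> letters of a closed subword longer than \<open>L\<close> are determined by the
  letters before them, which leaves at most \<open>abs_moment N L\<close> choices.
\<close>

lemma num_awords_minus_saw_count_le:
  assumes \<tau>: "\<tau> \<le> 1 / 2"
  shows "num_awords N L n - real (saw_count N n) \<le>
    2 * (real n + 1)\<^sup>2 * (abs_moment N L / (real N - h) ^ L) * num_awords N L n"
proof -
  \<comment> \<open>Here \<open>a\<close> is the start of the long closed subword and
    \<open>t\<close> the start of its last \<open>L\<close> letters; \<open>p\<close> is everything
    before those letters, so \<open>drop a p\<close> prescribes their parities.\<close>
  define Y where "Y a t = (SIGMA p:awords N L t. awords N L (n - t - L) \<times>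
    parity_words N L (odd_letters (drop a p)))" for a t
  define \<Phi> where "\<Phi> = (\<lambda>(p, q, m). p @ m @ q :: nat list)"
  have finY: "finite (Y a t)" for a t by (simp add: Y_def)
  have "awords N L n - awords N n n \<subseteq> (\<Union>(a, t)\<in>{..n} \<times> {..n}. \<Phi> ` (if t + L \<le> n then Y a t else {}))"
  proof
    fix w assume w: "w \<in> awords N L n - awords N n n"
    then obtain y where y: "sublist y w" "y \<noteq> []" "odd_letters y = {}"
      by (auto simp: awords_def avoiding_def)
    then have L: "L < length y" using w by (auto simp: awords_def avoiding_def)
    obtain p s where pq: "w = p @ y @ s" using y(1) by (auto simp: sublist_def)
    define y1 where "y1 = take (length y - L) y"
    define y2 where "y2 = drop (length y - L) y"
    have yy: "y = y1 @ y2" "length y2 = L" using L by (auto simp: y1_def y2_def)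
    have "sym_diff (odd_letters y1) (odd_letters y2) = {}" using y(3) by (simp add: yy odd_letters_append)
    then have "odd_letters y2 = odd_letters y1" by blast
    moreover have "drop (length p) (p @ y1) = y1" by simp
    moreover have "avoiding L (p @ y1)" "avoiding L s"
      using w avoiding_take[of L w "length (p @ y1)"] avoiding_drop[of L w "length (p @ y)"]
      by (auto simp: awords_def pq yy)
    ultimately have "(p @ y1, s, y2) \<in> Y (length p) (length (p @ y1))"
      using w by (auto simp: Y_def awords_def parity_words_def pq yy)
    moreover have "w = \<Phi> (p @ y1, s, y2)" by (simp add: \<Phi>_def pq yy)
    moreover have "length (p @ y1) + L \<le> n" "length p \<le> n"
      using w by (auto simp: awords_def pq yy)
    ultimately show "w \<in> (\<Union>(a, t)\<in>{..n} \<times> {..n}. \<Phi> ` (if t + L \<le> n then Y a t else {}))"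
      by (intro UN_I[of "(length p, length (p @ y1))"]) auto
  qed
  then have "card (awords N L n - awords N n n) \<le>
      card (\<Union>(a, t)\<in>{..n} \<times> {..n}. \<Phi> ` (if t + L \<le> n then Y a t else {}))"
    by (intro card_mono) (auto simp: finY)
  also have "\<dots> \<le> (\<Sum>(a, t)\<in>{..n} \<times> {..n}. card (\<Phi> ` (if t + L \<le> n then Y a t else {})))"
    using card_UN_le[of "{..n} \<times> {..n}" "\<lambda>(a, t). \<Phi> ` (if t + L \<le> n then Y a t else {})"]
    by (simp add: case_prod_unfold)
  also have "\<dots> \<le> (\<Sum>(a, t)\<in>{..n} \<times> {..n}. if t + L \<le> n then card (Y a t) else 0)"
    by (intro sum_mono, clarify) (simp add: card_image_le[OF finY])
  finally have "real (card (awords N L n - awords N n n)) \<le>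
      real (\<Sum>(a, t)\<in>{..n} \<times> {..n}. if t + L \<le> n then card (Y a t) else 0)"
    by (simp only: of_nat_le_iff)
  also have "\<dots> = (\<Sum>(a, t)\<in>{..n} \<times> {..n}. if t + L \<le> n then real (card (Y a t)) else 0)"
    by (simp add: case_prod_unfold if_distrib[of real] cong: if_cong)
  also have "\<dots> \<le> (\<Sum>(a, t)\<in>{..n} \<times> {..n}. 2 * (abs_moment N L / (real N - h) ^ L) * num_awords N L n)"
  proof (intro sum_mono, clarify)
    fix a t assume "a \<le> n" "t \<le> n"
    show "(if t + L \<le> n then real (card (Y a t)) else 0) \<le>
        2 * (abs_moment N L / (real N - h) ^ L) * num_awords N L n"
    proof (cases "t + L \<le> n")
      case True
      have "real (card (Y a t)) =
          (\<Sum>p\<in>awords N L t. num_awords N L (n - t - L) * real (card (parity_words N L (odd_letters (drop a p)))))"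
        by (simp add: Y_def card_SigmaI num_awords_def)
      also have "\<dots> \<le> (\<Sum>p\<in>awords N L t. num_awords N L (n - t - L) * abs_moment N L)"
        by (intro sum_mono mult_left_mono card_parity_words_le) auto
      also have "\<dots> = num_awords N L t * num_awords N L (n - t - L) * abs_moment N L" by (simp add: num_awords_def)
      also have "\<dots> \<le> 2 * num_awords N L (t + (n - t - L)) * abs_moment N L"
        using \<tau> abs_moment_nonneg by (intro mult_right_mono num_awords_mult_le) auto
      also have "t + (n - t - L) = n - L" using True by simp
      also have "num_awords N L (n - L) \<le> num_awords N L n / (real N - h) ^ L"
        using num_awords_minus_le[of L L n] True N_pos by (simp add: pos_le_divide_eq mult.commute)
      finally show ?thesis
        using True abs_moment_nonneg by (simp add: mult_right_mono mult_ac)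
    qed (use abs_moment_nonneg N_pos in simp)
  qed
  also have "\<dots> = 2 * (real n + 1)\<^sup>2 * (abs_moment N L / (real N - h) ^ L) * num_awords N L n"
    by (simp add: power2_eq_square algebra_simps add_divide_distrib)
  finally have "real (card (awords N L n - awords N n n)) \<le>
    2 * (real n + 1)\<^sup>2 * (abs_moment N L / (real N - h) ^ L) * num_awords N L n" .
  moreover have "awords N n n \<subseteq> awords N L n"
    by (rule awords_full_subset)
  then have "real (card (awords N L n - awords N n n)) = num_awords N L n - num_awords N n n"
    by (simp add: num_awords_def card_Diff_subset card_mono of_nat_diff)
  ultimately show ?thesis by (simp add: saw_count_eq_num_awords)
qed

lemma saw_count_le_num_awords: "real (saw_count N n) \<le> num_awords N L n"
proof -
  have "awords N n n \<subseteq> awords N L n"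
    by (rule awords_full_subset)
  then show ?thesis unfolding saw_count_eq_num_awords num_awords_def by (intro of_nat_mono card_mono) auto
qed

end

text \<open>The decay exp (-\<gamma> m) is split into two equal factors \<open>x ^ m\<close>. One is
  kept; the other converts N^m into \<open>(real N - h) ^ m\<close>, because
  \<open>real N * x \<le> real N - h\<close> for large \<open>N\<close>.\<close>

lemma few_loops_of_decay:
  fixes B \<gamma> :: real
  defines "x \<equiv> exp (- \<gamma> / 2)"
  defines "h \<equiv> B / (1 - x)"
  assumes B: "0 < B" and \<gamma>: "0 < \<gamma>" and N: "1 + 2 * h + h / (1 - x) \<le> real N"
    and decay: "\<And>m. 2 \<le> m \<Longrightarrow> m \<le> L \<Longrightarrow>
      abs_moment N m \<le> real N ^ m * (B / real N * exp (- \<gamma> * real m))"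
  shows "few_loops N L B x h"
proof
  show x: "0 < x" "x < 1" using \<gamma> by (simp_all add: x_def)
  then have h: "0 < h" using B by (simp add: h_def)
  then have pos: "0 \<le> h / (1 - x)" using x by simp
  show "2 * h \<le> real N" using N pos by linarith
  fix m assume m: "2 \<le> m" "m \<le> L"
  have "h / (1 - x) \<le> real N" using N h by linarith
  then have "h \<le> real N * (1 - x)" using x by (simp add: pos_divide_le_eq)
  then have "real N * x \<le> real N - h" by (simp add: algebra_simps)
  then have "(real N * x) ^ m \<le> (real N - h) ^ m" using x by (intro power_mono) auto
  moreover have "exp (- \<gamma> * real m) = x ^ m * x ^ m"
    unfolding x_def by (simp flip: exp_of_nat_mult exp_add)
  ultimately have "B / real N * x ^ m * (real N * x) ^ m \<le> B / real N * x ^ m * (real N - h) ^ m"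
    using B x by (intro mult_left_mono) auto
  moreover have "real (card (loops N m)) \<le> real N ^ m * (B / real N * (x ^ m * x ^ m))"
    using order_trans[OF card_loops_le decay[OF m]] \<open>exp (- \<gamma> * real m) = x ^ m * x ^ m\<close> by simp
  ultimately show "real (card (loops N m)) \<le> B / real N * x ^ m * (real N - h) ^ m"
    by (simp add: power_mult_distrib mult_ac)
qed (use B in \<open>simp_all add: h_def\<close>)

text \<open>The memory is \<open>L = K * N\<close>, long enough for mixing and short enough for the
  decay of closed words. The first error term is that of the bounded memory asymptotics, the second
  counts words with a closed subword longer than \<open>L\<close>.\<close>

lemma saw_count_asymptotics:
  assumes \<epsilon>: "\<epsilon> > 0"
  shows "\<exists>C>0. \<exists>N0. \<forall>N\<ge>N0. \<exists>A \<mu>. exp (- C) \<le> A \<and> A \<le> exp C \<and> real N / 2 \<le> \<mu> \<and>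
    (\<forall>n. \<bar>real (saw_count N n) / (A * \<mu> ^ n) - 1\<bar> \<le>
      C / (real n + 1) + C * (real n + 1)\<^sup>2 * (exp (\<epsilon> * real N) / 2 ^ N))"
proof -
  obtain K where K: "K \<ge> 1"
    "\<And>N. N \<ge> 1 \<Longrightarrow> abs_moment N (K * N) \<le> 2 * real N ^ (K * N) * (exp (\<epsilon> * real N) / 2 ^ N)"
    using abs_moment_mixed[OF \<epsilon>] by blast
  obtain B \<gamma> where B: "B > 0" and \<gamma>: "\<gamma> > 0" and decay: "\<And>N m. N \<ge> 1 \<Longrightarrow> 2 \<le> m \<Longrightarrow> m \<le> K * N \<Longrightarrow>
      abs_moment N m \<le> real N ^ m * (B / real N * exp (- \<gamma> * real m))"
    using abs_moment_decay[OF K(1)] by blast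
  define x where "x = exp (- \<gamma> / 2)"
  define h where "h = B / (1 - x)"
  have x: "0 < x" "x < 1" using \<gamma> by (simp_all add: x_def)
  have h: "h > 0" using B x by (simp add: h_def)
  obtain C1 where C1: "C1 > 0" and asym: "\<And>N L h. few_loops N L B x h \<Longrightarrow>
      few_loops.\<tau> N B x \<le> 1 / 2 \<Longrightarrow> 32 * few_loops.\<tau> N B x \<le> x ^ 4 \<Longrightarrow>
      \<exists>A \<mu>. exp (- C1) \<le> A \<and> A \<le> exp C1 \<and> real N / 2 \<le> \<mu> \<and> \<mu> \<le> real N \<and>
      (\<forall>n. \<bar>num_awords N L n / (A * \<mu> ^ n) - 1\<bar> \<le> C1 * exp C1 / (real n + 1))"
    using few_loops_asymptotics[OF x B] by blast
  \<comment> \<open>Chosen so that \<open>Q \<le> real N\<close> amounts to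
    \<open>32 * \<tau> \<le> x ^ 4\<close>.\<close>
  define Q where "Q = 32 * B / (1 - x)\<^sup>2 / x ^ 4"
  have Q: "Q > 0" using B x by (simp add: Q_def)
  define N0 where "N0 = nat \<lceil>1 + 2 * h + h / (1 - x) + Q\<rceil>"
  define C2 where "C2 = C1 * exp C1"
  define C3 where "C3 = 4 * exp (2 * h * real K)"
  define C where "C = C1 + C2 + C3 * (1 + C2)"
  have Cs: "C1 > 0" "C2 > 0" "C3 > 0" using C1 by (auto simp: C2_def C3_def)
  then have C: "C > 0" by (simp add: C_def add_pos_pos)
  have "\<exists>A \<mu>. exp (- C) \<le> A \<and> A \<le> exp C \<and> real N / 2 \<le> \<mu> \<and>
    (\<forall>n. \<bar>real (saw_count N n) / (A * \<mu> ^ n) - 1\<bar> \<le>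
      C / (real n + 1) + C * (real n + 1)\<^sup>2 * (exp (\<epsilon> * real N) / 2 ^ N))" if N: "N \<ge> N0" for N
  proof -
    define L where "L = K * N"
    have N': "1 + 2 * h + h / (1 - x) + Q \<le> real N" using N by (simp add: N0_def nat_le_iff ceiling_le_iff)
    moreover have "0 \<le> h / (1 - x)" using h x by simp
    ultimately have Nb: "1 + 2 * h + h / (1 - x) \<le> real N" "Q \<le> real N" "1 \<le> real N" "2 * h \<le> real N"
      using h Q by linarith+
    interpret few_loops N L B x h
      unfolding x_def h_def
      by (rule few_loops_of_decay) (use B \<gamma> Nb decay[of N] in \<open>auto simp: x_def h_def L_def\<close>)
    have \<tau>4: "32 * \<tau> \<le> x ^ 4"
    proof -
      have "32 * B / (1 - x)\<^sup>2 / x ^ 4 \<le> real N" using Nb(2) by (simp add: Q_def)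
      then have "32 * B / (1 - x)\<^sup>2 \<le> real N * x ^ 4"
        by (rule pos_divide_le_eq[THEN iffD1, rotated]) (use x in simp)
      then have "32 * B / (1 - x)\<^sup>2 / real N \<le> x ^ 4"
        using pos_divide_le_eq[OF N_pos(1), of "32 * B / (1 - x)\<^sup>2" "x ^ 4"] by (simp only: mult.commute)
      then show ?thesis by (simp add: \<tau>_def mult_ac)
    qed
    have "x ^ 4 \<le> 1" using x by (intro power_le_one) auto
    then have \<tau>2: "\<tau> \<le> 1 / 2" using \<tau>4 by linarith
    obtain A \<mu> where A: "exp (- C1) \<le> A" "A \<le> exp C1" and \<mu>: "real N / 2 \<le> \<mu>"
      and main: "\<And>n. \<bar>num_awords N L n / (A * \<mu> ^ n) - 1\<bar> \<le> C2 / (real n + 1)"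
      using asym[OF few_loops_axioms \<tau>2 \<tau>4] unfolding C2_def by blast
    have pos: "A > 0" "\<mu> > 0" using A(1) \<mu> Nb(3) exp_gt_zero[of "- C1"] by linarith+
    \<comment> \<open>Since \<open>L\<close> is proportional to \<open>N\<close>, replacing N^L by
      \<open>(real N - h) ^ L\<close> costs only a bounded factor.\<close>
    have long: "abs_moment N L / (real N - h) ^ L \<le> C3 / 2 * (exp (\<epsilon> * real N) / 2 ^ N)"
    proof -
      have "real N / (real N - h) = 1 + h / (real N - h)" using N_pos by (simp add: field_simps)
      also have "\<dots> \<le> 1 + h / (real N / 2)" using N_pos h Nb by (intro add_left_mono divide_left_mono) auto
      also have "\<dots> \<le> exp (2 * h / real N)"
        using exp_ge_add_one_self[of "2 * h / real N"] by (simp add: mult.commute)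
      finally have "(real N / (real N - h)) ^ L \<le> exp (2 * h / real N) ^ L"
        using N_pos by (intro power_mono) auto
      also have "\<dots> = exp (2 * h * real K)"
        using Nb(3) by (simp add: L_def flip: exp_of_nat_mult)
      finally have e: "(real N / (real N - h)) ^ L \<le> exp (2 * h * real K)" .
      have "abs_moment N L / (real N - h) ^ L \<le>
          2 * real N ^ L * (exp (\<epsilon> * real N) / 2 ^ N) / (real N - h) ^ L"
        unfolding L_def using K(2)[of N] Nb(3) N_pos by (intro divide_right_mono) auto
      also have "\<dots> = 2 * (real N / (real N - h)) ^ L * (exp (\<epsilon> * real N) / 2 ^ N)"
        by (simp add: power_divide)
      also have "\<dots> \<le> 2 * exp (2 * h * real K) * (exp (\<epsilon> * real N) / 2 ^ N)"
        using e by (intro mult_right_mono mult_left_mono) auto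
      finally show ?thesis by (simp add: C3_def)
    qed
    have "\<bar>real (saw_count N n) / (A * \<mu> ^ n) - 1\<bar> \<le>
      C / (real n + 1) + C * (real n + 1)\<^sup>2 * (exp (\<epsilon> * real N) / 2 ^ N)" for n
    proof -
      define v where "v = exp (\<epsilon> * real N) / 2 ^ N"
      have v: "v \<ge> 0" by (simp add: v_def)
      define D where "D = A * \<mu> ^ n"
      have D: "D > 0" using pos by (simp add: D_def)
      have "C2 / (real n + 1) \<le> C2 / 1" using Cs by (intro divide_left_mono) auto
      then have c1: "num_awords N L n / D \<le> 1 + C2" using main[of n] by (simp add: D_def abs_le_iff)
      have "2 * (real n + 1)\<^sup>2 * (abs_moment N L / (real N - h) ^ L) * num_awords N L n
         \<le> 2 * (real n + 1)\<^sup>2 * (C3 / 2 * v) * num_awords N L n"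
        using long unfolding v_def by (intro mult_right_mono mult_left_mono) auto
      then have "num_awords N L n - real (saw_count N n) \<le> (real n + 1)\<^sup>2 * (C3 * v) * num_awords N L n"
        using num_awords_minus_saw_count_le[OF \<tau>2, of n] by simp
      then have "(num_awords N L n - real (saw_count N n)) / D \<le> (real n + 1)\<^sup>2 * (C3 * v) * num_awords N L n / D"
        using D by (intro divide_right_mono) auto
      also have "\<dots> = (real n + 1)\<^sup>2 * (C3 * v) * (num_awords N L n / D)" by simp
      also have "\<dots> \<le> (real n + 1)\<^sup>2 * (C3 * v) * (1 + C2)"
        using c1 Cs v by (intro mult_left_mono) auto
      finally have d: "(num_awords N L n - real (saw_count N n)) / D \<le> (real n + 1)\<^sup>2 * (C3 * v) * (1 + C2)" .
      have "0 \<le> (num_awords N L n - real (saw_count N n)) / D"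
        using saw_count_le_num_awords[of n] D by simp
      then have "\<bar>real (saw_count N n) / D - 1\<bar> \<le> \<bar>num_awords N L n / D - 1\<bar> + (num_awords N L n - real (saw_count N n)) / D"
        by (simp add: diff_divide_distrib)
      also have "\<dots> \<le> C2 / (real n + 1) + (real n + 1)\<^sup>2 * (C3 * v) * (1 + C2)"
        using main[of n] d by (intro add_mono) (auto simp: D_def)
      also have "\<dots> = C2 / (real n + 1) + (C3 * (1 + C2)) * ((real n + 1)\<^sup>2 * v)" by simp
      also have "\<dots> \<le> C / (real n + 1) + C * ((real n + 1)\<^sup>2 * v)"
        using Cs v by (intro add_mono divide_right_mono mult_right_mono) (auto simp: C_def)
      finally show ?thesis by (simp add: D_def v_def mult.assoc)
    qed
    moreover have "C1 \<le> C" using Cs by (simp add: C_def)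
    then have "exp (- C) \<le> A" "A \<le> exp C"
      using A order_trans[of "exp (- C)" "exp (- C1)" A] order_trans[of A "exp C1" "exp C"] by auto
    ultimately show ?thesis using \<mu> by blast
  qed
  then show ?thesis using C by blast
qed

section \<open>The critical value\<close>

lemma critical_value_pos:
  assumes "N \<ge> 1" "lam * sqrt (real (volume N)) > 1"
  shows "critical_value N lam > 0"
  using theI'[OF critical_value_unique[OF assms]] by (simp add: critical_value_def)

lemma susceptibility_critical_value:
  assumes "N \<ge> 1" "lam * sqrt (real (volume N)) > 1"
  shows "susceptibility N (critical_value N lam) = lam * sqrt (real (volume N))"
  using theI'[OF critical_value_unique[OF assms]] by (simp add: critical_value_def)

lemma saw_count_term_le_susceptibility:
  assumes "0 \<le> z" "n \<le> volume N - 1"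
  shows "real (saw_count N n) * z ^ n \<le> susceptibility N z"
  unfolding susceptibility_def using assms
  by (intro member_le_sum[where f = "\<lambda>n. real (saw_count N n) * z ^ n"]) auto

text \<open>The asymptotics are useful only up to a length \<open>M\<close> well below the volume.
  Longer walks are cut into pieces of length \<open>M\<close> and a remainder, each piece costing
  another factor \<open>C\<close>.\<close>

lemma saw_count_le_submultiplicative:
  fixes \<mu> C :: real
  assumes \<mu>: "0 < \<mu>" and M: "1 \<le> M" and C: "1 \<le> C"
    and bound: "\<And>k. k \<le> M \<Longrightarrow> real (saw_count N k) \<le> C * \<mu> ^ k"
  shows "real (saw_count N n) \<le> C ^ Suc (n div M) * \<mu> ^ n"
proof (induction n rule: less_induct)
  case (less n)
  show ?case
  proof (cases "n < M")
    case True
    then show ?thesis using bound[of n] by simp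
  next
    case False
    then have n: "n = M + (n - M)" by simp
    have "real (saw_count N n) \<le> real (saw_count N M * saw_count N (n - M))"
      using saw_count_add_le[of N M "n - M"] n by (simp only: of_nat_le_iff)
    also have "\<dots> \<le> (C * \<mu> ^ M) * (C ^ Suc ((n - M) div M) * \<mu> ^ (n - M))"
      unfolding of_nat_mult using less[of "n - M"] bound[of M] False M \<mu> C
      by (intro mult_mono) auto
    also have "\<dots> = C ^ Suc (Suc ((n - M) div M)) * \<mu> ^ (M + (n - M))"
      by (simp add: power_add)
    also have "Suc ((n - M) div M) = n div M"
      using False M by (simp add: le_div_geq)
    finally show ?thesis using n by simp
  qed
qed

text \<open>One factor \<open>C\<close> per \<open>M\<close> steps amounts to
  \<open>exp (ln C / real M)\<close> per step. The hypothesis on \<open>\<mu> * z\<close> absorbs it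
  and leaves a geometric series of ratio \<open>exp (- a)\<close>.\<close>

lemma susceptibility_le_geometric:
  fixes \<mu> C a :: real
  assumes \<mu>: "0 < \<mu>" and M: "1 \<le> M" and C: "1 \<le> C" and a: "0 < a" and z: "0 < z"
    and bound: "\<And>k. k \<le> M \<Longrightarrow> real (saw_count N k) \<le> C * \<mu> ^ k"
    and small: "\<mu> * z \<le> exp (- (a + ln C / real M))"
  shows "susceptibility N z \<le> C * (1 + 1 / a)"
proof -
  have "real (saw_count N n) * z ^ n \<le> C * exp (- a) ^ n" for n
  proof -
    have lnC: "0 \<le> ln C" using C by simp
    have "n div M * M \<le> n" by simp
    then have "real (n div M) * real M \<le> real n" by (simp flip: of_nat_mult)
    then have "real (n div M) \<le> real n / real M" using M by (simp add: pos_le_divide_eq)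
    then have "real (n div M) * ln C \<le> real n / real M * ln C"
      using lnC by (rule mult_right_mono)
    then have "C ^ (n div M) \<le> exp (real n * (ln C / real M))"
    proof -
      have "C ^ (n div M) = exp (real (n div M) * ln C)"
        using C by (simp add: exp_of_nat_mult)
      then show ?thesis using \<open>real (n div M) * ln C \<le> real n / real M * ln C\<close> by simp
    qed
    moreover have "(\<mu> * z) ^ n \<le> exp (- (a + ln C / real M)) ^ n"
      using small \<mu> z by (intro power_mono) auto
    ultimately have "C ^ (n div M) * (\<mu> * z) ^ n \<le>
        exp (real n * (ln C / real M)) * exp (- (a + ln C / real M)) ^ n"
      using \<mu> z by (intro mult_mono) auto
    also have "\<dots> = exp (- a) ^ n"
      by (simp add: algebra_simps flip: exp_of_nat_mult exp_add)
    finally have e: "C ^ (n div M) * (\<mu> * z) ^ n \<le> exp (- a) ^ n" .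
    have "real (saw_count N n) * z ^ n \<le> (C ^ Suc (n div M) * \<mu> ^ n) * z ^ n"
      using saw_count_le_submultiplicative[OF \<mu> M C bound] z by (intro mult_right_mono) auto
    also have "\<dots> = C * (C ^ (n div M) * (\<mu> * z) ^ n)" by (simp add: power_mult_distrib)
    also have "\<dots> \<le> C * exp (- a) ^ n" using e C by (intro mult_left_mono) auto
    finally show ?thesis .
  qed
  then have "susceptibility N z \<le> (\<Sum>n = 0..volume N - 1. C * exp (- a) ^ n)"
    unfolding susceptibility_def by (intro sum_mono)
  also have "\<dots> = C * (\<Sum>n = 0..volume N - 1. exp (- a) ^ n)" by (simp add: sum_distrib_left)
  also have "\<dots> \<le> C * (exp (- a) ^ 0 / (1 - exp (- a)))"
    using C a by (intro mult_left_mono sum_geometric_le) auto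
  also have "\<dots> \<le> C * (1 + 1 / a)"
  proof -
    have "1 + a \<le> exp a" by (rule exp_ge_add_one_self)
    then have "exp (- a) \<le> 1 / (1 + a)" using a by (simp add: exp_minus field_simps)
    then have "a / (1 + a) \<le> 1 - exp (- a)" using a by (simp add: field_simps)
    then have "1 / (1 - exp (- a)) \<le> 1 / (a / (1 + a))"
      using a by (intro divide_left_mono) auto
    also have "\<dots> = 1 + 1 / a" using a by (simp add: field_simps)
    finally show ?thesis using C by (intro mult_left_mono) auto
  qed
  finally show ?thesis .
qed

text \<open>The growth rate \<open>\<mu>\<close> may be replaced by \<open>1 / z\<close> once the
  logarithm of \<open>\<mu> * z\<close> is known to be at most N^2/M in absolute value for some
  \<open>M\<close> much larger than n N^2. The quantity \<open>w\<close> tends to 0 with the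
  dimension, so the conditions on it only require \<open>N\<close> to be large.\<close>

lemma large_dimension_estimate:
  fixes lam p d C A \<mu> :: real and N :: nat
  defines "V \<equiv> real (volume N)"
  defines "z \<equiv> critical_value N lam"
  defines "C3 \<equiv> exp C * (1 + 5 * C)"
  defines "w \<equiv> real N ^ 2 * V powr (- d / 2)"
  assumes lam: "0 < lam" "lam \<le> 1" "lam * sqrt V > 1" and C: "C > 0"
    and p: "0 < p" "p = 1 / 2 - 2 * d" and d: "0 < d"
    and A: "exp (- C) \<le> A" "A \<le> exp C" and \<mu>: "0 < \<mu>"
    and asym: "\<And>n. \<bar>real (saw_count N n) / (A * \<mu> ^ n) - 1\<bar> \<le>
        C / (real n + 1) + C * (real n + 1)\<^sup>2 * V powr (d - 1)"
    and N: "12 * C + 3 \<le> real N"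
    and w: "10 * C * w \<le> 1" "3 * C3 * w < lam" "2 * w \<le> 1"
    and n: "1 \<le> n" "real n \<le> V powr p"
  shows "\<bar>real (saw_count N n) * z ^ n / A - 1\<bar> \<le> (15 * C + 3) * real n powr (- d)"
proof -
  have N3: "3 \<le> real N" using N C by linarith
  then have N1: "N \<ge> 1" by simp
  have V: "V = 2 ^ N" by (simp add: V_def volume_def)
  have "(2::real) ^ 3 \<le> 2 ^ N" using N3 by (intro power_increasing) auto
  then have V8: "8 \<le> V" by (simp add: V)
  then have V1: "1 < V" by simp
  have z0: "z > 0"
    unfolding z_def using N1 lam(3) V_def by (intro critical_value_pos) auto
  have chi: "susceptibility N z = lam * sqrt V"
    unfolding z_def V_def using N1 lam(3) V_def by (intro susceptibility_critical_value) auto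
  have A0: "A > 0" using A(1) exp_gt_zero[of "- C"] by linarith
  \<comment> \<open>The exponent is midway between \<open>p\<close> and 1/2: n/M is then of order
    V^(-d), while the error of order M^2 V^(d - 1) is also V^(-d), as 2q + d - 1 = -d.\<close>
  define q where "q = p + d"
  have q: "q = 1 / 2 - d" "d \<le> q" "0 < q" using p d by (auto simp: q_def)
  define M where "M = nat \<lfloor>V powr q\<rfloor>"
  have Vq1: "1 \<le> V powr q" using V1 q by (intro ge_one_powr_ge_zero) auto
  have M_le: "real M \<le> V powr q" and M_gt: "V powr q < real M + 1"
    using Vq1 by (simp_all add: M_def)
  have M1: "1 \<le> M" using Vq1 by (simp add: M_def le_nat_iff le_floor_iff)
  have M_half: "V powr q \<le> 2 * real M" using M_gt M1 by linarith
  have nM: "n \<le> M"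
  proof -
    have "V powr p \<le> V powr q" using V1 d by (intro powr_mono) (auto simp: q_def)
    then have "real n \<le> V powr q" using n by linarith
    then show ?thesis by (simp add: M_def le_nat_iff le_floor_iff)
  qed
  define u where "u = V powr (- d / 2)"
  have u: "0 < u" "u \<le> 1" using V1 d powr_mono[of "- d / 2" 0 V] by (auto simp: u_def)
  have w_def': "w = real N ^ 2 * u" by (simp add: w_def u_def)
  have uw: "u \<le> w"
    using mult_right_mono[of 1 "real N ^ 2" u] u N3 by (simp add: w_def' one_le_power)
  have uu: "V powr (- d) = u * u" by (simp add: u_def flip: powr_add)
  have uu_le: "u * u \<le> u" by (rule mult_left_le) (use u in auto)
  then have Vdw: "V powr (- d) \<le> w" using uw unfolding uu by linarith
  have Mq: "1 / (real M + 1) \<le> V powr (- d)"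
  proof -
    have "1 / (real M + 1) \<le> 1 / V powr q" using M_gt Vq1 by (intro divide_left_mono mult_pos_pos) auto
    also have "\<dots> = V powr (- q)" by (simp add: powr_minus_divide)
    also have "\<dots> \<le> V powr (- d)" using V1 q by (intro powr_mono) auto
    finally show ?thesis .
  qed
  have asym': "\<bar>real (saw_count N k) / (A * \<mu> ^ k) - 1\<bar> \<le> C / (real k + 1) + 4 * C * V powr (- d)"
    if "k \<le> M" for k
  proof -
    have "real k + 1 \<le> 2 * V powr q" using that M_le M1 Vq1 by linarith
    then have "(real k + 1)\<^sup>2 \<le> (2 * V powr q)\<^sup>2" by (intro power_mono) auto
    also have "\<dots> = 4 * V powr (2 * q)"
      by (simp add: power_mult_distrib power2_eq_square flip: powr_add)
    finally have "(real k + 1)\<^sup>2 * V powr (d - 1) \<le> 4 * V powr (2 * q) * V powr (d - 1)"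
      by (intro mult_right_mono) auto
    also have "\<dots> = 4 * V powr (- d)"
      using q by (simp add: mult.assoc flip: powr_add)
    finally have "C * ((real k + 1)\<^sup>2 * V powr (d - 1)) \<le> C * (4 * V powr (- d))"
      using C by (intro mult_left_mono) auto
    then show ?thesis using asym[of k] by (simp add: mult_ac)
  qed
  have upper: "real (saw_count N k) \<le> C3 * \<mu> ^ k" if "k \<le> M" for k
  proof -
    have "C / (real k + 1) \<le> C / 1" using C by (intro divide_left_mono) auto
    moreover have "C * V powr (- d) \<le> C * 1"
      using C uu u by (intro mult_left_mono) (auto simp: mult_le_one)
    ultimately have "real (saw_count N k) / (A * \<mu> ^ k) \<le> 1 + 5 * C"
      using asym'[OF that] by linarith
    then have "real (saw_count N k) \<le> (1 + 5 * C) * (A * \<mu> ^ k)"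
      using A0 \<mu> by (simp add: pos_divide_le_eq)
    also have "\<dots> \<le> (1 + 5 * C) * (exp C * \<mu> ^ k)"
      using A C \<mu> by (intro mult_left_mono mult_right_mono) auto
    finally show ?thesis by (simp add: C3_def mult_ac)
  qed
  have lower: "A / 2 * \<mu> ^ M \<le> real (saw_count N M)"
  proof -
    have "C / (real M + 1) \<le> C * V powr (- d)"
      using Mq C mult_left_mono[of "1 / (real M + 1)" "V powr (- d)" C] by simp
    moreover have "C * V powr (- d) \<le> C * w" using Vdw C by (intro mult_left_mono) auto
    ultimately have "1 / 2 \<le> real (saw_count N M) / (A * \<mu> ^ M)"
      using asym'[of M] w(1) by (simp add: abs_le_iff)
    then show ?thesis using A0 \<mu> by (simp add: pos_le_divide_eq)
  qed
  have C3: "1 \<le> C3" "ln C3 \<le> 6 * C"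
  proof -
    have "1 * 1 \<le> exp C * (1 + 5 * C)" using C by (intro mult_mono) auto
    then show "1 \<le> C3" by (simp add: C3_def)
    have "ln C3 = C + ln (1 + 5 * C)" using C by (simp add: C3_def ln_mult)
    also have "ln (1 + 5 * C) \<le> 5 * C" using C by (intro ln_add_one_self_le_self) auto
    finally show "ln C3 \<le> 6 * C" by simp
  qed
  define t where "t = real N ^ 2 / real M"
  have t: "0 < t" using N1 M1 by (simp add: t_def)
  have N2: "real N + C + 1 \<le> real N ^ 2" "12 * C \<le> real N ^ 2"
  proof -
    have "(12 * C + 3) * real N \<le> real N * real N" using N by (intro mult_right_mono) auto
    moreover have "C * 1 \<le> C * real N" using C N3 by (intro mult_left_mono) auto
    ultimately show "real N + C + 1 \<le> real N ^ 2" "12 * C \<le> real N ^ 2"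
      using C N3 unfolding power2_eq_square distrib_right by linarith+
  qed
  have sqrtV: "sqrt V = V powr (1 / 2)" using V1 by (simp add: powr_half_sqrt)
  have ln_le: "ln (\<mu> * z) \<le> t"
  proof -
    \<comment> \<open>The susceptibility ends at \<open>volume N - 1\<close>, so its term of index
      \<open>M\<close> exists only if \<open>M\<close> is below the volume.\<close>
    have "V powr q \<le> V powr (1 / 2)" using V1 q d by (intro powr_mono) auto
    moreover have "sqrt V \<le> V - 1"
    proof (rule real_le_lsqrt)
      have "V * 1 \<le> V * (V - 2)" using V8 by (intro mult_left_mono) auto
      then show "V \<le> (V - 1)\<^sup>2" by (simp add: power2_eq_square algebra_simps)
    qed (use V8 in auto)
    ultimately have "real M \<le> V - 1" using M_le sqrtV by linarith
    then have "M \<le> volume N - 1" unfolding V_def by linarith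
    then have "real (saw_count N M) * z ^ M \<le> lam * sqrt V"
      using saw_count_term_le_susceptibility[of z M N] z0 chi by simp
    moreover have "A / 2 * \<mu> ^ M * z ^ M \<le> real (saw_count N M) * z ^ M"
      using lower z0 by (intro mult_right_mono) auto
    moreover have "lam * sqrt V \<le> 1 * sqrt V" using lam V1 by (intro mult_right_mono) auto
    ultimately have "A * (\<mu> * z) ^ M \<le> 2 * sqrt V" by (simp add: power_mult_distrib)
    moreover have "exp (- C) * (\<mu> * z) ^ M \<le> A * (\<mu> * z) ^ M"
      using A \<mu> z0 by (intro mult_right_mono) auto
    ultimately have "exp (- C) * (\<mu> * z) ^ M \<le> 2 * sqrt V" by linarith
    then have "ln (exp (- C) * (\<mu> * z) ^ M) \<le> ln (2 * sqrt V)"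
      using \<mu> z0 V1 by (subst ln_le_cancel_iff) auto
    then have "real M * ln (\<mu> * z) \<le> C + ln 2 + real N / 2 * ln 2"
      using \<mu> z0 V1 by (simp add: ln_mult ln_realpow ln_sqrt V)
    also have "\<dots> \<le> C + 1 + real N"
    proof -
      have "ln (2::real) \<le> 1" using ln_2_less_1 by simp
      moreover have "real N / 2 * ln 2 \<le> real N / 2 * 1"
        using \<open>ln (2::real) \<le> 1\<close> by (intro mult_left_mono) auto
      ultimately show ?thesis by simp
    qed
    also have "\<dots> \<le> real N ^ 2" using N2 by simp
    finally show ?thesis using M1 by (simp add: t_def pos_le_divide_eq mult.commute)
  qed
  have ln_ge: "- t \<le> ln (\<mu> * z)"
  proof (rule ccontr)
    assume "\<not> - t \<le> ln (\<mu> * z)"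
    then have "exp (ln (\<mu> * z)) < exp (- t)" by simp
    then have "\<mu> * z < exp (- t)" using \<mu> z0 by simp
    \<comment> \<open>Half of \<open>t\<close> serves as the rate of the geometric series, the other
      half covers \<open>ln C3 / real M\<close>. The resulting bound on the susceptibility is of
      order V^q, too small to equal \<open>lam * sqrt V\<close>.\<close>
    also have "- t \<le> - (t / 2 + ln C3 / real M)"
    proof -
      have "ln C3 / real M \<le> (real N ^ 2 / 2) / real M"
        using C3 N2 by (intro divide_right_mono) auto
      then show ?thesis by (simp add: t_def)
    qed
    finally have "susceptibility N z \<le> C3 * (1 + 1 / (t / 2))"
      using upper \<mu> M1 C3 t z0 by (intro susceptibility_le_geometric[where M = M and \<mu> = \<mu>]) auto
    also have "1 + 1 / (t / 2) \<le> 3 * V powr q"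
    proof -
      have "1 / (t / 2) = 2 * real M / real N ^ 2" by (simp add: t_def)
      also have "\<dots> \<le> 2 * real M / 1"
        using N3 by (intro divide_left_mono) (auto simp: one_le_power)
      finally show ?thesis using M_le Vq1 by simp
    qed
    also have "C3 * (3 * V powr q) = 3 * C3 * V powr (- d) * V powr (1 / 2)"
      using q by (simp add: mult.assoc flip: powr_add)
    also have "\<dots> \<le> 3 * C3 * w * V powr (1 / 2)"
      using Vdw C3 by (intro mult_right_mono mult_left_mono) auto
    also have "\<dots> < lam * V powr (1 / 2)" using w(2) V1 by (intro mult_strict_right_mono) auto
    finally show False using chi C3 by (simp add: sqrtV)
  qed
  have nu: "u \<le> real n powr (- d)"
  proof -
    have "real n \<le> V powr (1 / 2)"
      using n(2) powr_mono[of p "1 / 2" V] V1 p d by linarith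
    then have "(V powr (1 / 2)) powr (- d) \<le> real n powr (- d)"
      using n(1) d by (intro powr_mono2') auto
    then show ?thesis by (simp add: u_def powr_powr)
  qed
  define y where "y = real n * ln (\<mu> * z)"
  \<comment> \<open>The ratio n/M provides \<open>u * u\<close>; one factor \<open>u\<close>
    compensates N^2 and gives \<open>w\<close>, the other one remains as the error.\<close>
  have y: "\<bar>y\<bar> \<le> u"
  proof -
    have "\<bar>y\<bar> \<le> real n * t" using ln_le ln_ge unfolding y_def abs_mult by (auto intro!: mult_left_mono)
    also have "\<dots> \<le> V powr p * (real N ^ 2 / (V powr q / 2))"
      unfolding t_def using n M_half Vq1 M1 by (intro mult_mono divide_left_mono mult_pos_pos) auto
    also have "\<dots> = 2 * real N ^ 2 * (V powr p * V powr (- q))"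
      by (simp add: powr_minus field_simps)
    also have "\<dots> = 2 * w * u"
      by (simp add: w_def' q_def uu flip: powr_add)
    also have "\<dots> \<le> 1 * u" using w(3) u by (intro mult_right_mono) auto
    finally show ?thesis by simp
  qed
  have y1: "\<bar>y\<bar> \<le> 1" using y u by linarith
  have ez: "exp y = (\<mu> * z) ^ n"
    using \<mu> z0 by (simp add: y_def exp_of_nat_mult)
  define \<alpha> where "\<alpha> = real (saw_count N n) / (A * \<mu> ^ n) - 1"
  have dn: "0 \<le> real n powr (- d)" by simp
  have \<alpha>: "\<bar>\<alpha>\<bar> \<le> 5 * C * real n powr (- d)"
  proof -
    have "C / (real n + 1) \<le> C * real n powr (- d)"
    proof -
      have "1 / (real n + 1) \<le> 1 / real n" using n by (intro divide_left_mono) auto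
      also have "\<dots> = real n powr (- 1)" using n by (simp add: powr_minus_divide)
      also have "\<dots> \<le> real n powr (- d)" using n p by (intro powr_mono) auto
      finally show ?thesis using C mult_left_mono[of "1 / (real n + 1)" "real n powr (- d)" C] by simp
    qed
    moreover have "u * u \<le> 1 * u" using u by (intro mult_right_mono) auto
    then have "4 * C * V powr (- d) \<le> 4 * C * real n powr (- d)"
      using nu uu C by (intro mult_left_mono) auto
    ultimately show ?thesis using asym'[OF nM] by (simp add: \<alpha>_def)
  qed
  have e3: "exp (1::real) \<le> 3" by (rule exp_le)
  have "exp y \<le> 3" using y1 e3 exp_le_cancel_iff[of y 1] by linarith
  have "\<bar>exp y - 1\<bar> \<le> exp 1 * \<bar>y\<bar>" by (rule abs_exp_minus_one_le[OF y1])
  also have "\<dots> \<le> 3 * u" using e3 y by (intro mult_mono) auto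
  finally have ey: "\<bar>exp y - 1\<bar> \<le> 3 * u" .
  have "real (saw_count N n) * z ^ n / A = (1 + \<alpha>) * exp y"
    using \<mu> by (simp add: \<alpha>_def ez power_mult_distrib)
  then have "\<bar>real (saw_count N n) * z ^ n / A - 1\<bar> = \<bar>\<alpha> * exp y + (exp y - 1)\<bar>"
    by (simp add: algebra_simps)
  also have "\<dots> \<le> \<bar>\<alpha>\<bar> * exp y + \<bar>exp y - 1\<bar>"
    by (rule order_trans[OF abs_triangle_ineq]) (simp add: abs_mult)
  also have "\<dots> \<le> 5 * C * real n powr (- d) * 3 + 3 * u"
    using \<alpha> ey \<open>exp y \<le> 3\<close> C by (intro add_mono mult_mono) auto
  also have "\<dots> \<le> (15 * C + 3) * real n powr (- d)"
    using nu by (simp add: algebra_simps)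
  finally show "\<bar>real (saw_count N n) * z ^ n / A - 1\<bar> \<le> (15 * C + 3) * real n powr (- d)" .
qed

section \<open>Assembly: choice of the exponent, and the finitely many small dimensions\<close>

theorem theorem1p2:
  "\<exists>lam0 > (0::real). \<exists>eps :: real \<Rightarrow> real.
     \<forall>lam p. 0 < lam \<and> lam \<le> lam0 \<and> 0 < p \<and> p < 1 / 2 \<longrightarrow>
       eps p > 0 \<and>
       (\<exists>(A :: nat \<Rightarrow> real) (C :: real) (E :: nat \<Rightarrow> nat \<Rightarrow> real).
          \<forall>n N. n \<ge> 1 \<and> N \<ge> 1 \<and> real n \<le> real (volume N) powr p \<and>
                 lam * sqrt (real (volume N)) > 1 \<longrightarrow>
            real (saw_count N n) = A N * connective_constant N lam ^ n * (1 + E n N) \<and>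
            \<bar>E n N\<bar> \<le> C * real n powr (- eps p))"
proof (intro exI[of _ 1] exI[of _ "\<lambda>p. (1 - 2 * p) / 4"] conjI allI impI)
  fix lam p :: real
  assume asm: "0 < lam \<and> lam \<le> 1 \<and> 0 < p \<and> p < 1 / 2"
  \<comment> \<open>Half the distance from \<open>p\<close> to 1/2; it is both the room for the
    auxiliary length \<open>M\<close> and the final error exponent.\<close>
  define d where "d = (1 - 2 * p) / 4"
  have d: "0 < d" "p = 1 / 2 - 2 * d" using asm by (auto simp: d_def field_simps)
  show "(1 - 2 * p) / 4 > 0" using asm by simp
  define \<epsilon> where "\<epsilon> = d * ln 2"
  have "\<epsilon> > 0" using d by (simp add: \<epsilon>_def)
  then obtain C N0 where C: "C > 0" and asym: "\<And>N. N \<ge> N0 \<Longrightarrow> \<exists>A \<mu>. exp (- C) \<le> A \<and> A \<le> exp C \<and>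
    real N / 2 \<le> \<mu> \<and> (\<forall>n. \<bar>real (saw_count N n) / (A * \<mu> ^ n) - 1\<bar> \<le>
      C / (real n + 1) + C * (real n + 1)\<^sup>2 * (exp (\<epsilon> * real N) / 2 ^ N))"
    using saw_count_asymptotics[of \<epsilon>] by blast
  have Vpow: "exp (\<epsilon> * real N) / 2 ^ N = real (volume N) powr (d - 1)" for N
  proof -
    have "real (volume N) powr d = exp (\<epsilon> * real N)"
      by (simp add: volume_def powr_def \<epsilon>_def ln_realpow mult_ac)
    then show ?thesis by (simp add: powr_diff volume_def)
  qed
  define w where "w N = real N ^ 2 * real (volume N) powr (- d / 2)" for N
  have "w \<longlonglongrightarrow> 0"
  proof -
    \<comment> \<open>The quantity \<open>w N\<close> is the square of
      \<open>real N * r ^ N\<close>.\<close>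
    define r :: real where "r = 2 powr (- d / 4)"
    have "norm r < 1" using d powr_less_one[of 2 "- d / 4"] by (simp add: r_def)
    then have lim: "(\<lambda>N. real N * r ^ N) \<longlonglongrightarrow> 0" by (rule powser_times_n_limit_0)
    have "(real N * r ^ N) * (real N * r ^ N) = w N" for N
    proof -
      have "r ^ N * r ^ N = real (volume N) powr (- d / 2)"
        by (simp add: r_def volume_def powr_def ln_realpow flip: exp_of_nat_mult exp_add)
      then show ?thesis by (simp add: w_def power2_eq_square mult_ac)
    qed
    then show ?thesis using tendsto_mult[OF lim lim] by simp
  qed
  define C3 where "C3 = exp C * (1 + 5 * C)"
  \<comment> \<open>The three entries are the thresholds for \<open>w\<close> demanded by
    \<open>large_dimension_estimate\<close>.\<close>
  define \<theta> where "\<theta> = min (1 / (10 * C)) (min (lam / (3 * C3)) (1 / 2))"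
  have C3: "C3 > 0" using C by (simp add: C3_def)
  have \<theta>: "\<theta> > 0" using C C3 asm by (simp add: \<theta>_def)
  have "eventually (\<lambda>N. w N < \<theta>) sequentially"
    using order_tendstoD(2)[OF \<open>w \<longlonglongrightarrow> 0\<close> \<theta>] .
  then obtain N2 where N2: "\<And>N. N \<ge> N2 \<Longrightarrow> w N < \<theta>" by (auto simp: eventually_sequentially)
  define N1 where "N1 = max N0 (max N2 (nat \<lceil>12 * C + 3\<rceil>))"
  obtain A0 \<mu>0 where A0: "\<And>N. N \<ge> N1 \<Longrightarrow> exp (- C) \<le> A0 N \<and> A0 N \<le> exp C \<and>
    real N / 2 \<le> \<mu>0 N \<and> (\<forall>n. \<bar>real (saw_count N n) / (A0 N * \<mu>0 N ^ n) - 1\<bar> \<le>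
      C / (real n + 1) + C * (real n + 1)\<^sup>2 * real (volume N) powr (d - 1))"
    using asym unfolding Vpow N1_def by (metis max.bounded_iff)
  \<comment> \<open>Below the threshold dimension any positive amplitude will do, since
    \<open>E\<close> is defined by solving the desired equation for the error.\<close>
  define A where "A N = (if N \<ge> N1 then A0 N else 1)" for N
  define E where "E n N = real (saw_count N n) * critical_value N lam ^ n / A N - 1" for n N
  \<comment> \<open>For the finitely many small dimensions only lengths \<open>n\<close> up to the
    volume matter, because p < 1; the sum of all these errors is a constant that dominates each of
    them.\<close>
  define S where "S = (\<Sum>N<N1. \<Sum>n\<le>2 ^ N. \<bar>E n N\<bar> * real n powr d)"
  have "real (saw_count N n) = A N * connective_constant N lam ^ n * (1 + E n N) \<and>
      \<bar>E n N\<bar> \<le> (15 * C + 3 + S) * real n powr (- d)"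
    if h: "n \<ge> 1" "N \<ge> 1" "real n \<le> real (volume N) powr p" "lam * sqrt (real (volume N)) > 1" for n N
  proof -
    have z: "critical_value N lam > 0" using critical_value_pos h by blast
    have "0 < A0 N" if "N \<ge> N1" using A0[OF that] exp_gt_zero[of "- C"] by linarith
    then have "A N > 0" unfolding A_def by simp
    then have 1: "real (saw_count N n) = A N * connective_constant N lam ^ n * (1 + E n N)"
      using z by (simp add: E_def connective_constant_def power_divide)
    have S0: "0 \<le> S" unfolding S_def by (intro sum_nonneg) auto
    have "\<bar>E n N\<bar> \<le> (15 * C + 3 + S) * real n powr (- d)"
    proof (cases "N \<ge> N1")
      case True
      have wN: "w N < \<theta>" using N2 True by (simp add: N1_def)
      have "nat \<lceil>12 * C + 3\<rceil> \<le> N1" unfolding N1_def by (intro max.coboundedI2 order_refl)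
      then have "12 * C + 3 \<le> real N"
        using True by (intro order_trans[OF real_nat_ceiling_ge of_nat_mono]) simp
      moreover have "10 * C * w N \<le> 1" "3 * C3 * w N < lam" "2 * w N \<le> 1"
      proof -
        have "w N < 1 / (10 * C)" "w N < lam / (3 * C3)" "w N < 1 / 2"
          using wN by (simp_all add: \<theta>_def)
        then show "10 * C * w N \<le> 1" "3 * C3 * w N < lam" "2 * w N \<le> 1"
          using C C3 by (simp_all add: pos_less_divide_eq mult_ac)
      qed
      moreover have "0 < \<mu>0 N" using A0[OF True] h(2) by (auto intro: less_le_trans[of 0 "real N / 2"])
      ultimately have "\<bar>real (saw_count N n) * critical_value N lam ^ n / A0 N - 1\<bar> \<le>
          (15 * C + 3) * real n powr (- d)"
        using A0[OF True] asm C d h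
        by (intro large_dimension_estimate[where p = p and \<mu> = "\<mu>0 N"])
          (auto simp: w_def C3_def)
      moreover have "0 \<le> S * real n powr (- d)" using S0 by simp
      ultimately show ?thesis using True by (simp add: E_def A_def distrib_right)
    next
      case False
      have "real (volume N) powr p \<le> real (volume N) powr 1"
        using asm by (intro powr_mono) (auto simp: volume_def)
      also have "\<dots> = real (volume N)" by simp
      finally have "real n \<le> real (volume N)" using h(3) by linarith
      then have nV: "n \<le> 2 ^ N" by (simp only: of_nat_le_iff volume_def)
      have "\<bar>E n N\<bar> * real n powr d \<le> (\<Sum>n\<le>2 ^ N. \<bar>E n N\<bar> * real n powr d)"
        using nV by (intro member_le_sum[where f = "\<lambda>n. \<bar>E n N\<bar> * real n powr d"]) auto
      also have "\<dots> \<le> S"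
        unfolding S_def using False
        by (intro member_le_sum[where f = "\<lambda>N. \<Sum>n\<le>2 ^ N. \<bar>E n N\<bar> * real n powr d"])
          (auto intro!: sum_nonneg)
      finally have "\<bar>E n N\<bar> * real n powr d * real n powr (- d) \<le> (15 * C + 3 + S) * real n powr (- d)"
        using C by (intro mult_right_mono) auto
      then show ?thesis using h(1) by (simp add: mult.assoc flip: powr_add)
    qed
    with 1 show ?thesis by simp
  qed
  then show "\<exists>A C E. \<forall>n N. n \<ge> 1 \<and> N \<ge> 1 \<and> real n \<le> real (volume N) powr p \<and>
                 lam * sqrt (real (volume N)) > 1 \<longrightarrow>
            real (saw_count N n) = A N * connective_constant N lam ^ n * (1 + E n N) \<and>
            \<bar>E n N\<bar> \<le> C * real n powr (- ((1 - 2 * p) / 4))"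
    unfolding d_def[symmetric] by blast
qed simp

end
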